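(* Let $M$ be a convex $\sigma$-MV-algebra, $N$ a convex $\sigma$-MV-subalgebra of $M$, and $m$ a $\sigma$-additive state on $M$. Let $\mathcal I_m=\{a\in M:m(a)=0\}$, $\tilde M=M/\mathcal I_m$, and $\tilde N=\{[a]:a\in N\}\subseteq\tilde M$. Define $\tau:\tilde M\to\tilde M$ by $\tau[a]:=[\eta(m(a|N))]$, where $m(a|N)$ is the MV-conditional expectation of $a$ given $N$ in the state $m$. Then $\tau$ is a (well-defined) strong state operator on $\tilde M$, and the range of $\tau$ is $\tau(\tilde M)=\tilde N$.
   Context: MV-algebras $(M;\boxplus,{}',0)$ are regarded as effect algebras: with $a\boxdot b=(a'\boxplus b')'$, the orthosum $a\oplus b:=a\boxplus b$ is defined iff $a\boxdot b=0$. A $\sigma$-MV-algebra is an MV-algebra that is a $\sigma$-complete lattice; a $\sigma$-MV-subalgebra is a sub-MV-algebra closed under countable suprema of $M$. $M$ is convex if there is a map $[0,1]\times M\to M$, $(\lambda,a)\mapsto\lambda a$, with $\alpha(\beta a)=(\alpha\beta)a$; $(\alpha+\beta)a=\alpha a\oplus\beta a$ if $\alpha+\beta\le1$; $\lambda(a\oplus b)=\lambda a\oplus\lambda b$ if $a\oplus b$ is defined; $1a=a$. A sub-MV-algebra $N$ is convex if $a\in N$, $\alpha\in[0,1]$ imply $\alpha a\in N$. A state is a map $m:M\to[0,1]$ with $m(1)=1$ and $m(a\oplus b)=m(a)+m(b)$ whenever $a\oplus b$ is defined; it is $\sigma$-additive if $a_n\nearrow a$ implies $m(a_n)\nearrow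 m(a)$. A tribe over a set $X$ is a set $\mathcal T\subseteq[0,1]^X$ containing $0$ and closed under $f\mapsto 1-f$, $(f,g)\mapsto\min(f+g,1)$, and pointwise limits of increasing sequences; $\mathcal B(\mathcal T)$ denotes the $\sigma$-algebra of sets $B\subseteq X$ with $\chi_B\in\mathcal T$. For an MV-algebra $M$, $\mathcal B(M)=\{a\in M:a\boxplus a=a\}$. Loomis–Sikorski representation: let $X$ be the compact Hausdorff space of extremal (finitely additive) states on $M$ and $a^*(\omega)=\omega(a)$ for $a\in M$, $\omega\in X$. There is a tribe $M^*$ over $X$ and a $\sigma$-homomorphism $\eta$ of $M^*$ onto $M$ such that $a^*$ is the unique continuous function in $M^*$ with $\eta(a^* )=a$, and $f\in M^*$ has $\eta(f)=a$ iff $\{f\neq a^*\}$ is meager. $N^*$ is the sub-tribe of $M^*$ generated by $\{b^*:b\in N\}$. Put $m^*=m\circ\eta$ and $P^*(A)=m^*(\chi_A)$ for $A\in\mathcal B(M^* )$, a probability measure; for $b\in M$ put $P^*_{b^*}(A)=m^*(b^*\wedge\chi_A)$. The MV-conditional expectation of $a\in M$ given $N$ in the state $m$ is a $\mathcal B(N^* )$-measurable function $m(a|N)=m(a|\mathcal B(N)):X\to\mathbb R$ such that $\int_X m(a|N)\,dP^*_{b^*}=m(a\wedge b)$ for all $b\in\mathcal B(N)$. It exists, is unique $P^*$-a.e., and satisfies $0\le m(a|N)\le1$ $P^*$-a.e.; a $[0,1]$-valued version is always chosen, and when $M$ and $N$ are convex this version belongs to $N^*\subseteq M^*$, so $\eta(m(a|N))\in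 N$ is defined. $[a]$ is the class of $a$ in the quotient of $M$ by the MV-ideal $\mathcal I_m$: $a_1\sim a_2$ iff $m(a_1\Delta a_2)=0$, where $a_1\Delta a_2=(a_1\vee a_2)\ominus(a_1\wedge a_2)$ (here $b\ominus a$ is the $c$ with $a\oplus c=b$). A state operator on an effect algebra $E$ is a map $\tau:E\to E$ with $\tau(1)=1$; $\tau(e\oplus f)=\tau(e)\oplus\tau(f)$ whenever $e\oplus f$ is defined; $\tau\circ\tau=\tau$. It is strong if $\tau(\tau(a)\wedge\tau(b))=\tau(a)\wedge\tau(b)$ whenever $\tau(a)\wedge\tau(b)$ exists. *)

theory Defs
  imports "HOL-Analysis.Analysis" "HOL-Algebra.Order"
begin

section \<open>Effect algebras and state operators\<close>

text \<open>The partial sum is an option-valued function; \<open>None\<close> means undefined.\<close>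

record 'a effect_algebra = "'a partial_object" +
  osum :: "'a \<Rightarrow> 'a \<Rightarrow> 'a option"
  ezero :: 'a
  eone :: 'a

locale effect_algebra =
  fixes E :: "('a, 'e) effect_algebra_scheme"
  assumes zero_closed: "ezero E \<in> carrier E"
    and one_closed: "eone E \<in> carrier E"
    and osum_closed: "\<lbrakk>a \<in> carrier E; b \<in> carrier E; osum E a b = Some c\<rbrakk> \<Longrightarrow> c \<in> carrier E"
    and osum_comm: "\<lbrakk>a \<in> carrier E; b \<in> carrier E\<rbrakk> \<Longrightarrow> osum E a b = osum E b a"
    and osum_assoc:
      "\<lbrakk>a \<in> carrier E; b \<in> carrier E; c \<in> carrier E; osum E a b = Some x; osum E x c = Some y\<rbrakk>
        \<Longrightarrow> \<exists>z. osum E b c = Some z \<and> osum E a z = Some y"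
    and orthosupplement:
      "a \<in> carrier E \<Longrightarrow> \<exists>!b. b \<in> carrier E \<and> osum E a b = Some (eone E)"
    and zero_one_law: "\<lbrakk>a \<in> carrier E; osum E a (eone E) \<noteq> None\<rbrakk> \<Longrightarrow> a = ezero E"

definition ea_order :: "('a, 'e) effect_algebra_scheme \<Rightarrow> 'a gorder" where
  "ea_order E = \<lparr>carrier = carrier E, eq = (=),
     le = (\<lambda>a b. \<exists>c\<in>carrier E. osum E a c = Some b)\<rparr>"

locale state_operator = effect_algebra E
  for E :: "('a, 'e) effect_algebra_scheme" +
  fixes \<tau> :: "'a \<Rightarrow> 'a"
  assumes maps: "\<tau> \<in> carrier E \<rightarrow> carrier E"
    and unit: "\<tau> (eone E) = eone E"
    and additive: "\<lbrakk>e \<in> carrier E; f \<in> carrier E; osum E e f = Some g\<rbrakk>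
        \<Longrightarrow> osum E (\<tau> e) (\<tau> f) = Some (\<tau> g)"
    and idempotent: "e \<in> carrier E \<Longrightarrow> \<tau> (\<tau> e) = \<tau> e"

locale strong_state_operator = state_operator E \<tau>
  for E :: "('a, 'e) effect_algebra_scheme" and \<tau> :: "'a \<Rightarrow> 'a" +
  assumes strong: "\<lbrakk>a \<in> carrier E; b \<in> carrier E;
        greatest (ea_order E) i (Lower (ea_order E) {\<tau> a, \<tau> b})\<rbrakk> \<Longrightarrow> \<tau> i = i"


section \<open>MV-algebras\<close>

record 'a mv_algebra = "'a partial_object" +
  mv_plus :: "'a \<Rightarrow> 'a \<Rightarrow> 'a"
  mv_neg :: "'a \<Rightarrow> 'a"
  mv_zero :: 'a

locale mv_algebra =
  fixes M :: "('a, 'm) mv_algebra_scheme"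
  assumes zero_closed: "mv_zero M \<in> carrier M"
    and neg_closed: "a \<in> carrier M \<Longrightarrow> mv_neg M a \<in> carrier M"
    and plus_closed: "\<lbrakk>a \<in> carrier M; b \<in> carrier M\<rbrakk> \<Longrightarrow> mv_plus M a b \<in> carrier M"
    and plus_assoc: "\<lbrakk>a \<in> carrier M; b \<in> carrier M; c \<in> carrier M\<rbrakk>
        \<Longrightarrow> mv_plus M (mv_plus M a b) c = mv_plus M a (mv_plus M b c)"
    and plus_comm: "\<lbrakk>a \<in> carrier M; b \<in> carrier M\<rbrakk> \<Longrightarrow> mv_plus M a b = mv_plus M b a"
    and plus_zero: "a \<in> carrier M \<Longrightarrow> mv_plus M a (mv_zero M) = a"
    and neg_neg: "a \<in> carrier M \<Longrightarrow> mv_neg M (mv_neg M a) = a"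
    and plus_one: "a \<in> carrier M \<Longrightarrow> mv_plus M a (mv_neg M (mv_zero M)) = mv_neg M (mv_zero M)"
    and lukasiewicz: "\<lbrakk>a \<in> carrier M; b \<in> carrier M\<rbrakk>
        \<Longrightarrow> mv_plus M (mv_neg M (mv_plus M (mv_neg M a) b)) b
          = mv_plus M (mv_neg M (mv_plus M (mv_neg M b) a)) a"

definition mv_one :: "('a, 'm) mv_algebra_scheme \<Rightarrow> 'a" where
  "mv_one M = mv_neg M (mv_zero M)"

definition mv_times :: "('a, 'm) mv_algebra_scheme \<Rightarrow> 'a \<Rightarrow> 'a \<Rightarrow> 'a" where
  "mv_times M a b = mv_neg M (mv_plus M (mv_neg M a) (mv_neg M b))"

definition mv_join :: "('a, 'm) mv_algebra_scheme \<Rightarrow> 'a \<Rightarrow> 'a \<Rightarrow> 'a" where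
  "mv_join M a b = mv_plus M (mv_neg M (mv_plus M (mv_neg M a) b)) b"

definition mv_meet :: "('a, 'm) mv_algebra_scheme \<Rightarrow> 'a \<Rightarrow> 'a \<Rightarrow> 'a" where
  "mv_meet M a b = mv_neg M (mv_join M (mv_neg M a) (mv_neg M b))"

definition mv_order :: "('a, 'm) mv_algebra_scheme \<Rightarrow> 'a gorder" where
  "mv_order M = \<lparr>carrier = carrier M, eq = (=),
     le = (\<lambda>a b. mv_plus M (mv_neg M a) b = mv_one M)\<rparr>"

definition mv_is_sup :: "('a, 'm) mv_algebra_scheme \<Rightarrow> 'a set \<Rightarrow> 'a \<Rightarrow> bool" where
  "mv_is_sup M A s \<longleftrightarrow> least (mv_order M) s (Upper (mv_order M) A)"

definition mv_is_inf :: "('a, 'm) mv_algebra_scheme \<Rightarrow> 'a set \<Rightarrow> 'a \<Rightarrow> bool" where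
  "mv_is_inf M A i \<longleftrightarrow> greatest (mv_order M) i (Lower (mv_order M) A)"

definition mv_orth :: "('a, 'm) mv_algebra_scheme \<Rightarrow> 'a \<Rightarrow> 'a \<Rightarrow> bool" where
  "mv_orth M a b \<longleftrightarrow> mv_times M a b = mv_zero M"

definition mv_effect :: "('a, 'm) mv_algebra_scheme \<Rightarrow> 'a effect_algebra" where
  "mv_effect M = \<lparr>carrier = carrier M,
     osum = (\<lambda>a b. if mv_orth M a b then Some (mv_plus M a b) else None),
     ezero = mv_zero M, eone = mv_one M\<rparr>"

text \<open>\<open>mv_minus M b a\<close> is \<open>b \<ominus> a\<close>, meaningful only for \<open>a \<le> b\<close>.\<close>

definition mv_minus :: "('a, 'm) mv_algebra_scheme \<Rightarrow> 'a \<Rightarrow> 'a \<Rightarrow> 'a" where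
  "mv_minus M b a = (THE c. c \<in> carrier M \<and> osum (mv_effect M) a c = Some b)"

definition mv_symdiff :: "('a, 'm) mv_algebra_scheme \<Rightarrow> 'a \<Rightarrow> 'a \<Rightarrow> 'a" where
  "mv_symdiff M a b = mv_minus M (mv_join M a b) (mv_meet M a b)"

definition mv_boolean :: "('a, 'm) mv_algebra_scheme \<Rightarrow> 'a set \<Rightarrow> 'a set" where
  "mv_boolean M N = {a \<in> N. mv_plus M a a = a}"

locale sigma_mv_algebra = mv_algebra M for M :: "('a, 'm) mv_algebra_scheme" +
  assumes countable_sup: "\<lbrakk>A \<subseteq> carrier M; A \<noteq> {}; countable A\<rbrakk> \<Longrightarrow> \<exists>s. mv_is_sup M A s"
    and countable_inf: "\<lbrakk>A \<subseteq> carrier M; A \<noteq> {}; countable A\<rbrakk> \<Longrightarrow> \<exists>i. mv_is_inf M A i"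

definition sigma_mv_subalgebra :: "'a set \<Rightarrow> ('a, 'm) mv_algebra_scheme \<Rightarrow> bool" where
  "sigma_mv_subalgebra N M \<longleftrightarrow>
     N \<subseteq> carrier M \<and> mv_zero M \<in> N \<and> (\<forall>a\<in>N. mv_neg M a \<in> N) \<and>
     (\<forall>a\<in>N. \<forall>b\<in>N. mv_plus M a b \<in> N) \<and>
     (\<forall>A s. A \<subseteq> N \<and> A \<noteq> {} \<and> countable A \<and> mv_is_sup M A s \<longrightarrow> s \<in> N)"

definition convex_structure ::
    "('a, 'm) mv_algebra_scheme \<Rightarrow> (real \<Rightarrow> 'a \<Rightarrow> 'a) \<Rightarrow> bool" where
  "convex_structure M sc \<longleftrightarrow>
     (\<forall>\<alpha>\<in>{0..1}. \<forall>a\<in>carrier M. sc \<alpha> a \<in> carrier M) \<and>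
     (\<forall>\<alpha>\<in>{0..1}. \<forall>\<beta>\<in>{0..1}. \<forall>a\<in>carrier M. sc \<alpha> (sc \<beta> a) = sc (\<alpha> * \<beta>) a) \<and>
     (\<forall>\<alpha>\<in>{0..1}. \<forall>\<beta>\<in>{0..1}. \<forall>a\<in>carrier M. \<alpha> + \<beta> \<le> 1 \<longrightarrow>
        osum (mv_effect M) (sc \<alpha> a) (sc \<beta> a) = Some (sc (\<alpha> + \<beta>) a)) \<and>
     (\<forall>\<alpha>\<in>{0..1}. \<forall>a\<in>carrier M. \<forall>b\<in>carrier M. \<forall>c. osum (mv_effect M) a b = Some c \<longrightarrow>
        osum (mv_effect M) (sc \<alpha> a) (sc \<alpha> b) = Some (sc \<alpha> c)) \<and>
     (\<forall>a\<in>carrier M. sc 1 a = a)"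

definition convex_sub :: "(real \<Rightarrow> 'a \<Rightarrow> 'a) \<Rightarrow> 'a set \<Rightarrow> bool" where
  "convex_sub sc N \<longleftrightarrow> (\<forall>\<alpha>\<in>{0..1}. \<forall>a\<in>N. sc \<alpha> a \<in> N)"

definition sigma_mv_hom ::
    "('a, 'm) mv_algebra_scheme \<Rightarrow> ('b, 'n) mv_algebra_scheme \<Rightarrow> ('a \<Rightarrow> 'b) \<Rightarrow> bool" where
  "sigma_mv_hom A B h \<longleftrightarrow>
     h \<in> carrier A \<rightarrow> carrier B \<and> h (mv_zero A) = mv_zero B \<and>
     (\<forall>a\<in>carrier A. h (mv_neg A a) = mv_neg B (h a)) \<and>
     (\<forall>a\<in>carrier A. \<forall>b\<in>carrier A. h (mv_plus A a b) = mv_plus B (h a) (h b)) \<and>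
     (\<forall>S s. S \<subseteq> carrier A \<and> S \<noteq> {} \<and> countable S \<and> mv_is_sup A S s \<longrightarrow>
        mv_is_sup B (h ` S) (h s))"


section \<open>States and quotients\<close>

definition mv_state :: "('a, 'm) mv_algebra_scheme \<Rightarrow> ('a \<Rightarrow> real) \<Rightarrow> bool" where
  "mv_state M m \<longleftrightarrow>
     m \<in> carrier M \<rightarrow> {0..1} \<and> m (mv_one M) = 1 \<and>
     (\<forall>a\<in>carrier M. \<forall>b\<in>carrier M. \<forall>c. osum (mv_effect M) a b = Some c \<longrightarrow> m c = m a + m b)"

definition mv_sigma_additive :: "('a, 'm) mv_algebra_scheme \<Rightarrow> ('a \<Rightarrow> real) \<Rightarrow> bool" where
  "mv_sigma_additive M m \<longleftrightarrow>
     (\<forall>f a. (\<forall>n::nat. f n \<in> carrier M) \<and> (\<forall>n. le (mv_order M) (f n) (f (Suc n))) \<and>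
        mv_is_sup M (range f) a \<longrightarrow>
        incseq (\<lambda>n. m (f n)) \<and> (\<lambda>n. m (f n)) \<longlonglongrightarrow> m a)"

definition mv_null_ideal :: "('a, 'm) mv_algebra_scheme \<Rightarrow> ('a \<Rightarrow> real) \<Rightarrow> 'a set" where
  "mv_null_ideal M m = {a \<in> carrier M. m a = 0}"

definition mv_class :: "('a, 'm) mv_algebra_scheme \<Rightarrow> 'a set \<Rightarrow> 'a \<Rightarrow> 'a set" where
  "mv_class M I a = {b \<in> carrier M. mv_symdiff M a b \<in> I}"

text \<open>The operations of the quotient are those induced on representatives: each union below
  is over equal sets when \<open>I\<close> is an MV-ideal.\<close>

definition mv_quotient :: "('a, 'm) mv_algebra_scheme \<Rightarrow> 'a set \<Rightarrow> 'a set mv_algebra" where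
  "mv_quotient M I = \<lparr>carrier = mv_class M I ` carrier M,
     mv_plus = (\<lambda>A B. \<Union>a\<in>A. \<Union>b\<in>B. mv_class M I (mv_plus M a b)),
     mv_neg = (\<lambda>A. \<Union>a\<in>A. mv_class M I (mv_neg M a)),
     mv_zero = mv_class M I (mv_zero M)\<rparr>"


section \<open>Tribes and the Loomis--Sikorski representation\<close>

text \<open>Functions on a set \<open>X\<close> are represented by total functions that are \<open>undefined\<close>
  outside \<open>X\<close>, so that equality of functions is equality on \<open>X\<close>.\<close>

definition tribe :: "'x set \<Rightarrow> ('x \<Rightarrow> real) set \<Rightarrow> bool" where
  "tribe X T \<longleftrightarrow>
     T \<subseteq> X \<rightarrow>\<^sub>E {0..1} \<and> (\<lambda>x\<in>X. 0) \<in> T \<and>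
     (\<forall>f\<in>T. (\<lambda>x\<in>X. 1 - f x) \<in> T) \<and>
     (\<forall>f\<in>T. \<forall>g\<in>T. (\<lambda>x\<in>X. min (f x + g x) 1) \<in> T) \<and>
     (\<forall>f g. (\<forall>n::nat. f n \<in> T) \<and> (\<forall>x\<in>X. incseq (\<lambda>n. f n x) \<and> (\<lambda>n. f n x) \<longlonglongrightarrow> g x) \<and>
        g \<in> extensional X \<longrightarrow> g \<in> T)"

definition tribe_mv :: "'x set \<Rightarrow> ('x \<Rightarrow> real) set \<Rightarrow> ('x \<Rightarrow> real) mv_algebra" where
  "tribe_mv X T = \<lparr>carrier = T,
     mv_plus = (\<lambda>f g. \<lambda>x\<in>X. min (f x + g x) 1),
     mv_neg = (\<lambda>f. \<lambda>x\<in>X. 1 - f x),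
     mv_zero = (\<lambda>x\<in>X. 0)\<rparr>"

definition generated_tribe :: "'x set \<Rightarrow> ('x \<Rightarrow> real) set \<Rightarrow> ('x \<Rightarrow> real) set" where
  "generated_tribe X G = \<Inter>{T. tribe X T \<and> G \<subseteq> T}"

definition tribe_sets :: "'x set \<Rightarrow> ('x \<Rightarrow> real) set \<Rightarrow> 'x set set" where
  "tribe_sets X T = {B. B \<subseteq> X \<and> (\<lambda>x\<in>X. indicator B x) \<in> T}"

definition ext_states :: "('a, 'm) mv_algebra_scheme \<Rightarrow> ('a \<Rightarrow> real) set" where
  "ext_states M = {\<omega> \<in> extensional (carrier M). mv_state M \<omega> \<and>
     (\<forall>s1 s2 t. mv_state M s1 \<and> mv_state M s2 \<and> 0 < t \<and> t < 1 \<and>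
        (\<forall>a\<in>carrier M. \<omega> a = t * s1 a + (1 - t) * s2 a) \<longrightarrow>
        (\<forall>a\<in>carrier M. s1 a = s2 a))}"

text \<open>The topology of pointwise convergence.\<close>

definition ext_top :: "('a, 'm) mv_algebra_scheme \<Rightarrow> ('a \<Rightarrow> real) topology" where
  "ext_top M = subtopology (product_topology (\<lambda>_. euclideanreal) (carrier M)) (ext_states M)"

definition mv_star :: "('a, 'm) mv_algebra_scheme \<Rightarrow> 'a \<Rightarrow> ('a \<Rightarrow> real) \<Rightarrow> real" where
  "mv_star M a = (\<lambda>\<omega>\<in>ext_states M. \<omega> a)"

definition meager_in :: "'x topology \<Rightarrow> 'x set \<Rightarrow> bool" where
  "meager_in T S \<longleftrightarrow> (\<exists>\<C>. countable \<C> \<and> S \<subseteq> \<Union>\<C> \<and>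
     (\<forall>C\<in>\<C>. C \<subseteq> topspace T \<and> T interior_of (T closure_of C) = {}))"

definition loomis_sikorski ::
    "('a, 'm) mv_algebra_scheme \<Rightarrow> (('a \<Rightarrow> real) \<Rightarrow> real) set \<Rightarrow> ((('a \<Rightarrow> real) \<Rightarrow> real) \<Rightarrow> 'a) \<Rightarrow> bool"
  where
  "loomis_sikorski M Ms \<eta> \<longleftrightarrow>
     tribe (ext_states M) Ms \<and>
     sigma_mv_hom (tribe_mv (ext_states M) Ms) M \<eta> \<and> \<eta> ` Ms = carrier M \<and>
     (\<forall>a\<in>carrier M. \<forall>f. f = mv_star M a \<longleftrightarrow>
        f \<in> Ms \<and> continuous_map (ext_top M) euclideanreal f \<and> \<eta> f = a) \<and>
     (\<forall>a\<in>carrier M. \<forall>f\<in>Ms.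
        \<eta> f = a \<longleftrightarrow> meager_in (ext_top M) {\<omega> \<in> ext_states M. f \<omega> \<noteq> mv_star M a \<omega>})"

definition sub_star :: "('a, 'm) mv_algebra_scheme \<Rightarrow> 'a set \<Rightarrow> (('a \<Rightarrow> real) \<Rightarrow> real) set" where
  "sub_star M N = generated_tribe (ext_states M) (mv_star M ` N)"


section \<open>MV-conditional expectation\<close>

text \<open>\<open>P_star M Ms \<eta> m b\<close> is the measure \<open>A \<mapsto> m (\<eta> (b\<^sup>* \<and> \<chi>\<^sub>A))\<close> on the
  \<open>\<sigma>\<close>-algebra of the tribe \<open>Ms\<close>; the meet of functions is pointwise.\<close>

definition P_star ::
    "('a, 'm) mv_algebra_scheme \<Rightarrow> (('a \<Rightarrow> real) \<Rightarrow> real) set \<Rightarrow> ((('a \<Rightarrow> real) \<Rightarrow> real) \<Rightarrow> 'a) \<Rightarrow>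
     ('a \<Rightarrow> real) \<Rightarrow> 'a \<Rightarrow> ('a \<Rightarrow> real) measure" where
  "P_star M Ms \<eta> m b = measure_of (ext_states M) (tribe_sets (ext_states M) Ms)
     (\<lambda>A. ennreal (m (\<eta> (\<lambda>\<omega>\<in>ext_states M. min (mv_star M b \<omega>) (indicator A \<omega>)))))"

text \<open>\<open>f\<close> is a version of the MV-conditional expectation of \<open>a\<close> given \<open>N\<close> in the state \<open>m\<close>.
  Integrability is stated since the Bochner integral of a non-integrable function is \<open>0\<close>.\<close>

definition mv_cond_exp ::
    "('a, 'm) mv_algebra_scheme \<Rightarrow> (('a \<Rightarrow> real) \<Rightarrow> real) set \<Rightarrow> ((('a \<Rightarrow> real) \<Rightarrow> real) \<Rightarrow> 'a) \<Rightarrow>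
     'a set \<Rightarrow> ('a \<Rightarrow> real) \<Rightarrow> 'a \<Rightarrow> (('a \<Rightarrow> real) \<Rightarrow> real) \<Rightarrow> bool" where
  "mv_cond_exp M Ms \<eta> N m a f \<longleftrightarrow>
     f \<in> extensional (ext_states M) \<and>
     f \<in> borel_measurable (sigma (ext_states M) (tribe_sets (ext_states M) (sub_star M N))) \<and>
     (\<forall>b\<in>mv_boolean M N. integrable (P_star M Ms \<eta> m b) f \<and>
        (\<integral>\<omega>. f \<omega> \<partial>P_star M Ms \<eta> m b) = m (mv_meet M a b))"

definition mv_cond_exp01 ::
    "('a, 'm) mv_algebra_scheme \<Rightarrow> (('a \<Rightarrow> real) \<Rightarrow> real) set \<Rightarrow> ((('a \<Rightarrow> real) \<Rightarrow> real) \<Rightarrow> 'a) \<Rightarrow>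
     'a set \<Rightarrow> ('a \<Rightarrow> real) \<Rightarrow> 'a \<Rightarrow> (('a \<Rightarrow> real) \<Rightarrow> real) \<Rightarrow> bool" where
  "mv_cond_exp01 M Ms \<eta> N m a f \<longleftrightarrow>
     mv_cond_exp M Ms \<eta> N m a f \<and> f \<in> ext_states M \<rightarrow> {0..1}"

text \<open>The map \<open>[a] \<mapsto> [\<eta> (m(a|N))]\<close>. The description operator yields the intended class only if
  that class depends neither on the representative \<open>a\<close> nor on the chosen version.\<close>

definition cond_exp_operator ::
    "('a, 'm) mv_algebra_scheme \<Rightarrow> (('a \<Rightarrow> real) \<Rightarrow> real) set \<Rightarrow> ((('a \<Rightarrow> real) \<Rightarrow> real) \<Rightarrow> 'a) \<Rightarrow>
     'a set \<Rightarrow> ('a \<Rightarrow> real) \<Rightarrow> 'a set \<Rightarrow> 'a set" where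
  "cond_exp_operator M Ms \<eta> N m C =
     (THE D. \<exists>a f. a \<in> carrier M \<and> C = mv_class M (mv_null_ideal M m) a \<and>
        mv_cond_exp01 M Ms \<eta> N m a f \<and> D = mv_class M (mv_null_ideal M m) (\<eta> f))"

end

theory Submission
  imports Defs "HOL-Probability.Conditional_Expectation"
begin

text \<open>
  A \<sigma>-additive state on a tribe that contains the constants is integration against a probability
  measure, and such a tribe consists of all \<open>[0,1]\<close>-valued functions measurable for its \<sigma>-algebra.
  Convexity puts the constants into \<open>N\<^sup>*\<close> and \<open>M\<^sup>*\<close>, because \<open>\<omega> (r 1) = r\<close> for every state \<open>\<omega>\<close>.
  Hence \<open>m \<circ> \<eta>\<close> is integration against \<open>P\<^sup>*\<close>, the quotient of \<open>M\<close> is the algebra of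
  \<open>[0,1]\<close>-valued \<open>M\<^sup>*\<close>-functions modulo \<open>P\<^sup>*\<close>-almost everywhere equality, and \<open>P\<^sup>*\<close> with index \<open>b\<^sup>*\<close>
  has density \<open>b\<^sup>*\<close>. Since every set in the \<sigma>-algebra of \<open>N\<^sup>*\<close> agrees almost everywhere with \<open>b\<^sup>*\<close>
  for some Boolean \<open>b \<in> N\<close>, the MV-conditional expectation is the classical one of \<open>a\<^sup>*\<close>, and
  \<open>\<tau>\<close> is the classical conditional expectation operator.
\<close>

text \<open>Computations inside \<open>M\<close> are replaced by pointwise ones: each element is
  \<open>\<eta> f\<close> for some \<open>f\<close> of the tribe, identities between real functions
  are carried over by \<open>\<eta>\<close>, and \<open>star\<close> supplies an injective
  representation where cancellation is at stake. For the quotient all of \<open>Ms\<close> has to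
  serve as representatives, not only the continuous functions \<open>star a\<close>, because
  indicators and conditional expectations are in general not continuous. Classes are therefore
  handled up to null sets throughout.

  The obstacle on the way to integrals is that a tribe has neither scalar multiples nor sums beyond
  1, and a state is additive only on sums bounded by 1. Homogeneity must be won from additivity and
  nonnegativity, and the usual induction over nonnegative measurable functions needs a scaling
  factor that keeps every intermediate function below 1. The constants serve a second purpose: they
  turn the level sets \<open>{f > a}\<close> into supports of truncated differences.\<close>

section \<open>Additive functions on the unit interval\<close>

text \<open>Cauchy's equation on an interval: additivity fixes the values at \<open>k / n\<close>,
  nonnegativity makes \<open>\<phi>\<close> monotone, and monotonicity squeezes the remaining
  values. It is applied to \<open>L\<close> on multiples of an indicator and to a state on multiples
  of the unit.\<close>

lemma additive_unit_interval_linear: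
  fixes \<phi> :: "real \<Rightarrow> real"
  assumes nonneg: "\<And>r. r \<in> {0..1} \<Longrightarrow> 0 \<le> \<phi> r"
    and add: "\<And>r s. r \<in> {0..1} \<Longrightarrow> s \<in> {0..1} \<Longrightarrow> r + s \<le> 1 \<Longrightarrow> \<phi> (r + s) = \<phi> r + \<phi> s"
    and r: "r \<in> {0..1}"
  shows "\<phi> r = r * \<phi> 1"
proof -
  have mono: "\<phi> s \<le> \<phi> t" if "0 \<le> s" "s \<le> t" "t \<le> 1" for s t
    using add[of s "t - s"] nonneg[of "t - s"] that by auto
  have zero: "\<phi> 0 = 0" using add[of 0 0] by auto
  have mult: "\<phi> (real k * s) = real k * \<phi> s" if "0 \<le> s" "real k * s \<le> 1" for k s
    using that
  proof (induction k)
    case (Suc k)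
    have "real k * s + s \<le> 1" using Suc.prems by (simp add: algebra_simps)
    moreover have "0 \<le> real k * s" using Suc.prems(1) by simp
    ultimately have "real k * s \<le> 1" "s \<le> 1" using Suc.prems(1) by linarith+
    then have "\<phi> (real k * s + s) = \<phi> (real k * s) + \<phi> s"
      using Suc.prems(1) \<open>real k * s + s \<le> 1\<close> by (intro add) auto
    with Suc.IH Suc.prems \<open>real k * s + s \<le> 1\<close> show ?case by (simp add: algebra_simps)
  qed (simp add: zero)
  have frac: "\<phi> (real k / real n) = real k / real n * \<phi> 1" if "0 < n" "k \<le> n" for k n :: nat
    using mult[of "1 / real n" k] mult[of "1 / real n" n] that by (simp add: field_simps)
  have close: "\<bar>\<phi> r - r * \<phi> 1\<bar> \<le> \<phi> 1 / real n" if n: "0 < n" for n :: nat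
  proof (cases "r = 1")
    case True
    then show ?thesis using nonneg[of 1] by simp
  next
    case False
    \<comment> \<open>\<open>k / n\<close> and \<open>(k + 1) / n\<close> enclose \<open>r\<close>.
      The case \<open>r = 1\<close> is set apart because only \<open>r < 1\<close> guarantees
      \<open>k + 1 \<le> n\<close>, so that the upper point stays in the domain.\<close>
    define k where "k = nat \<lfloor>r * real n\<rfloor>"
    have k: "real k \<le> r * real n" "r * real n < real k + 1"
      using r n unfolding k_def by (auto simp: le_nat_iff)
    have "r * real n < real n" using False r n by simp
    then have kn: "Suc k \<le> n" using k by linarith
    have lower: "real k / real n \<le> r" and upper: "r \<le> real (Suc k) / real n"
      using k n by (auto simp: field_simps)
    have "real (Suc k) / real n \<le> 1" using kn n by simp
    then have "\<phi> (real k / real n) \<le> \<phi> r" "\<phi> r \<le> \<phi> (real (Suc k) / real n)"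
      using lower upper r by (auto intro!: mono)
    then have "real k / real n * \<phi> 1 \<le> \<phi> r" "\<phi> r \<le> real (Suc k) / real n * \<phi> 1"
      using frac[of n k] frac[of n "Suc k"] kn n by auto
    moreover have "real k / real n * \<phi> 1 \<le> r * \<phi> 1" "r * \<phi> 1 \<le> real (Suc k) / real n * \<phi> 1"
      using mult_right_mono[OF lower nonneg[of 1]] mult_right_mono[OF upper nonneg[of 1]] by simp_all
    moreover have "real (Suc k) / real n * \<phi> 1 = real k / real n * \<phi> 1 + \<phi> 1 / real n"
      by (simp add: add_divide_distrib distrib_right)
    ultimately show ?thesis by (auto simp: abs_le_iff)
  qed
  have "(\<lambda>n. \<phi> 1 / real n) \<longlonglongrightarrow> 0"
    by (rule lim_const_over_n)
  then have "\<bar>\<phi> r - r * \<phi> 1\<bar> \<le> 0"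
    by (rule LIMSEQ_le_const) (use close in \<open>auto intro!: exI[of _ 1]\<close>)
  then show ?thesis by simp
qed

section \<open>Tribes\<close>

lemma tribe_PiE: "tribe X T \<Longrightarrow> f \<in> T \<Longrightarrow> f \<in> X \<rightarrow>\<^sub>E {0..1}"
  unfolding tribe_def by blast

lemma tribe_range: "tribe X T \<Longrightarrow> f \<in> T \<Longrightarrow> x \<in> X \<Longrightarrow> 0 \<le> f x \<and> f x \<le> 1"
  using PiE_mem[OF tribe_PiE, of X T f x] by simp

lemma tribe_extensional: "tribe X T \<Longrightarrow> f \<in> T \<Longrightarrow> f \<in> extensional X"
  using tribe_PiE[of X T f] by (simp add: PiE_iff)

lemma tribe_zero: "tribe X T \<Longrightarrow> (\<lambda>x\<in>X. 0) \<in> T"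
  and tribe_compl: "tribe X T \<Longrightarrow> f \<in> T \<Longrightarrow> (\<lambda>x\<in>X. 1 - f x) \<in> T"
  and tribe_plus: "tribe X T \<Longrightarrow> f \<in> T \<Longrightarrow> g \<in> T \<Longrightarrow> (\<lambda>x\<in>X. min (f x + g x) 1) \<in> T"
  unfolding tribe_def by blast+

lemma tribe_lim:
  assumes "tribe X T" "\<And>n::nat. f n \<in> T" "\<And>x. x \<in> X \<Longrightarrow> incseq (\<lambda>n. f n x)"
    "\<And>x. x \<in> X \<Longrightarrow> (\<lambda>n. f n x) \<longlonglongrightarrow> g x"
  shows "restrict g X \<in> T"
proof -
  have "\<forall>x\<in>X. incseq (\<lambda>n. f n x) \<and> (\<lambda>n. f n x) \<longlonglongrightarrow> restrict g X x"
    using assms(3,4) by simp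
  then show ?thesis
    using assms(1,2) unfolding tribe_def by (meson restrict_extensional)
qed

lemma tribe_one: "tribe X T \<Longrightarrow> (\<lambda>x\<in>X. 1) \<in> T"
  using tribe_compl[OF _ tribe_zero, of X T X] by (simp cong: restrict_cong)

text \<open>In MV terms this is the negation of \<open>(1 - f) \<oplus> g\<close>. The lattice
  operations are not among the axioms of a tribe; minimum and absolute difference are built from
  this one.\<close>

lemma tribe_diff:
  assumes T: "tribe X T" "f \<in> T" "g \<in> T"
  shows "(\<lambda>x\<in>X. max (f x - g x) 0) \<in> T"
proof -
  have "(\<lambda>x\<in>X. 1 - (\<lambda>x\<in>X. min ((\<lambda>x\<in>X. 1 - f x) x + g x) 1) x) \<in> T"
    by (intro tribe_compl tribe_plus T)
  also have "(\<lambda>x\<in>X. 1 - (\<lambda>x\<in>X. min ((\<lambda>x\<in>X. 1 - f x) x + g x) 1) x) = (\<lambda>x\<in>X. max (f x - g x) 0)"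
    by (auto simp: fun_eq_iff)
  finally show ?thesis .
qed

lemma tribe_min:
  assumes T: "tribe X T" "f \<in> T" "g \<in> T"
  shows "(\<lambda>x\<in>X. min (f x) (g x)) \<in> T"
proof -
  have "(\<lambda>x\<in>X. max (f x - (\<lambda>x\<in>X. max (f x - g x) 0) x) 0) \<in> T"
    by (intro tribe_diff T)
  also have "(\<lambda>x\<in>X. max (f x - (\<lambda>x\<in>X. max (f x - g x) 0) x) 0) = (\<lambda>x\<in>X. min (f x) (g x))"
    using tribe_range[OF T(1,2)] tribe_range[OF T(1,3)] by (auto simp: fun_eq_iff)
  finally show ?thesis .
qed

text \<open>The two truncated differences are never both positive, so the cut at 1 in their sum is
  inactive.\<close>

lemma tribe_absdiff:
  assumes T: "tribe X T" "f \<in> T" "g \<in> T"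
  shows "(\<lambda>x\<in>X. \<bar>f x - g x\<bar>) \<in> T"
proof -
  have "(\<lambda>x\<in>X. min ((\<lambda>x\<in>X. max (f x - g x) 0) x + (\<lambda>x\<in>X. max (g x - f x) 0) x) 1) \<in> T" (is "?h \<in> _")
    by (intro tribe_diff tribe_plus T)
  also have "?h = (\<lambda>x\<in>X. \<bar>f x - g x\<bar>)"
    using tribe_range[OF T(1,2)] tribe_range[OF T(1,3)]
    by (force simp: fun_eq_iff min_def max_def abs_if)
  finally show ?thesis .
qed

lemma tribe_mult_trunc:
  assumes T: "tribe X T" "f \<in> T"
  shows "(\<lambda>x\<in>X. min (real n * f x) 1) \<in> T"
proof (induction n)
  case 0
  then show ?case using tribe_zero[OF T(1)] by (simp add: restrict_def min_def cong: if_cong)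
next
  case (Suc n)
  have "(\<lambda>x\<in>X. min ((\<lambda>x\<in>X. min (real n * f x) 1) x + f x) 1) \<in> T" (is "?h \<in> _")
    by (rule tribe_plus[OF T(1) Suc T(2)])
  also have "?h = (\<lambda>x\<in>X. min (real (Suc n) * f x) 1)"
    using tribe_range[OF T] by (force simp: fun_eq_iff min_def algebra_simps)
  finally show ?case .
qed

text \<open>Truncated multiples \<open>min (n * f) 1\<close> increase to the indicator of the
  support. This is the passage from functions of a tribe to sets of its \<sigma>-algebra.\<close>

lemma tribe_sets_support:
  assumes T: "tribe X T" "f \<in> T"
  shows "{x \<in> X. 0 < f x} \<in> tribe_sets X T"
proof -
  have "(\<lambda>x\<in>X. indicator {x \<in> X. 0 < f x} x) \<in> T"
  proof (rule tribe_lim[OF T(1) tribe_mult_trunc[OF T]])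
    fix x assume x: "x \<in> X"
    show "incseq (\<lambda>n. (\<lambda>x\<in>X. min (real n * f x) 1) x)"
      using tribe_range[OF T x] x
      by (auto simp: incseq_def min_le_iff_disj intro!: mult_right_mono)
    show "(\<lambda>n. (\<lambda>x\<in>X. min (real n * f x) 1) x) \<longlonglongrightarrow> indicator {x \<in> X. 0 < f x} x"
    proof (cases "0 < f x")
      case True
      \<comment> \<open>Beyond \<open>1 / f x\<close> the truncated multiple equals 1 exactly, so
        the sequence is eventually constant.\<close>
      obtain k :: nat where k: "1 / f x < real k" using reals_Archimedean2 by blast
      have "\<forall>\<^sub>F n in sequentially. min (real n * f x) 1 = 1"
      proof (rule eventually_sequentiallyI)
        fix n assume "k \<le> n"
        then have "real k * f x \<le> real n * f x" using True by simp
        moreover have "1 < real k * f x" using k True by (simp add: divide_less_eq)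
        ultimately show "min (real n * f x) 1 = 1" by linarith
      qed
      then show ?thesis using x True by (auto intro: tendsto_eventually)
    next
      case False
      then have "f x = 0" using tribe_range[OF T x] by simp
      then show ?thesis using x by simp
    qed
  qed
  then show ?thesis by (auto simp: tribe_sets_def)
qed

lemma restrict_indicator_empty [simp]: "restrict (indicat_real {}) X = (\<lambda>x\<in>X. 0)"
  by (simp add: fun_eq_iff restrict_def)

lemma sigma_algebra_tribe_sets:
  assumes T: "tribe X T"
  shows "sigma_algebra X (tribe_sets X T)"
  unfolding sigma_algebra_iff2
proof (intro conjI ballI allI impI)
  show "tribe_sets X T \<subseteq> Pow X" by (auto simp: tribe_sets_def)
  show "{} \<in> tribe_sets X T" using tribe_zero[OF T] by (simp add: tribe_sets_def)
next
  fix A assume "A \<in> tribe_sets X T"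
  then have "(\<lambda>x\<in>X. indicator A x) \<in> T" by (simp add: tribe_sets_def)
  then have "(\<lambda>x\<in>X. 1 - (\<lambda>x\<in>X. indicator A x) x) \<in> T" (is "?c \<in> T")
    by (rule tribe_compl[OF T])
  moreover have "?c = (\<lambda>x\<in>X. indicator (X - A) x)"
    by (auto simp: fun_eq_iff indicator_def)
  ultimately show "X - A \<in> tribe_sets X T" by (auto simp: tribe_sets_def)
next
  fix A :: "nat \<Rightarrow> 'a set" assume "range A \<subseteq> tribe_sets X T"
  then have A: "(\<lambda>x\<in>X. indicator (A i) x) \<in> T" "A i \<subseteq> X" for i
    by (auto simp: tribe_sets_def)
  have fin: "(\<lambda>x\<in>X. indicator (\<Union>i<n. A i) x) \<in> T" for n
  proof (induction n)
    case 0
    then show ?case using tribe_zero[OF T] by (simp add: restrict_def)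
  next
    case (Suc n)
    have "(\<lambda>x\<in>X. min ((\<lambda>x\<in>X. indicator (\<Union>i<n. A i) x) x + (\<lambda>x\<in>X. indicator (A n) x) x) 1) \<in> T" (is "?h \<in> _")
      by (rule tribe_plus[OF T Suc A(1)])
    also have "?h = (\<lambda>x\<in>X. indicator (\<Union>i<Suc n. A i) x)"
      by (auto simp: fun_eq_iff indicator_def less_Suc_eq)
    finally show ?case .
  qed
  have "(\<lambda>x\<in>X. indicator (\<Union>i. A i) x) \<in> T"
  proof (rule tribe_lim[OF T fin])
    fix x assume x: "x \<in> X"
    show "incseq (\<lambda>n. (\<lambda>x\<in>X. indicator (\<Union>i<n. A i) x :: real) x)"
      using x by (auto simp: incseq_def indicator_def)
    show "(\<lambda>n. (\<lambda>x\<in>X. indicator (\<Union>i<n. A i) x) x) \<longlonglongrightarrow> (indicator (\<Union>i. A i) x :: real)"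
      using x by (simp add: LIMSEQ_indicator_UN)
  qed
  then show "(\<Union>i. A i) \<in> tribe_sets X T"
    using A(2) by (auto simp: tribe_sets_def)
qed

text \<open>The tribe \<open>T\<close> above \<open>G\<close> makes the intersected family nonempty;
  an empty intersection would be the set of all functions.\<close>

lemma tribe_generated: "tribe X T \<Longrightarrow> G \<subseteq> T \<Longrightarrow> tribe X (generated_tribe X G)"
proof -
  assume "tribe X T" "G \<subseteq> T"
  then have ex: "T \<in> {T. tribe X T \<and> G \<subseteq> T}" by simp
  show ?thesis
    unfolding tribe_def[of X "generated_tribe X G"]
  proof (intro conjI ballI allI impI)
    show "generated_tribe X G \<subseteq> X \<rightarrow>\<^sub>E {0..1}"
      using ex unfolding generated_tribe_def tribe_def by blast
    show "g \<in> generated_tribe X G"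
      if "(\<forall>n::nat. f n \<in> generated_tribe X G) \<and>
        (\<forall>x\<in>X. incseq (\<lambda>n. f n x) \<and> (\<lambda>n. f n x) \<longlonglongrightarrow> g x) \<and> g \<in> extensional X" for f g
      using that tribe_lim[of X _ f g] unfolding generated_tribe_def
      by (auto simp: extensional_restrict)
  qed (auto simp: generated_tribe_def tribe_zero tribe_compl tribe_plus)
qed

section \<open>Tribes with constants as spaces of measurable functions\<close>

locale const_tribe =
  fixes X :: "'x set" and T :: "('x \<Rightarrow> real) set"
  assumes tribe: "tribe X T"
    and const: "r \<in> {0..1} \<Longrightarrow> (\<lambda>x\<in>X. r) \<in> T"
begin

definition \<S> :: "'x measure" where "\<S> = sigma X (tribe_sets X T)"

lemma space_\<S> [simp]: "space \<S> = X"
  unfolding \<S>_def by (rule space_measure_of) (auto simp: tribe_sets_def)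

lemma sets_\<S> [simp]: "sets \<S> = tribe_sets X T"
  unfolding \<S>_def
  by (rule sigma_algebra.sets_measure_of_eq[OF sigma_algebra_tribe_sets[OF tribe]])

text \<open>The level set at \<open>a\<close> is the support of the truncated difference of
  \<open>f\<close> and the constant \<open>a\<close>, which lies in the tribe as soon as the
  constant does.\<close>

lemma measurable:
  assumes f: "f \<in> T"
  shows "f \<in> borel_measurable \<S>"
  unfolding borel_measurable_iff_greater
proof
  fix a :: real
  have range: "0 \<le> f x \<and> f x \<le> 1" if "x \<in> X" for x
    using tribe_range[OF tribe f that] .
  \<comment> \<open>Only constants from the unit interval are available; for other levels the set is
    everything or empty.\<close>
  consider "a < 0" | "a > 1" | "a \<in> {0..1}" by fastforce
  then show "{w \<in> space \<S>. a < f w} \<in> sets \<S>"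
  proof cases
    case 1
    then have "{w \<in> space \<S>. a < f w} = space \<S>" using range by fastforce
    then show ?thesis by (metis sets.top)
  next
    case 2
    then have "{w \<in> space \<S>. a < f w} = {}" using range by fastforce
    then show ?thesis by (metis sets.empty_sets)
  next
    case 3
    have "(\<lambda>x\<in>X. max (f x - (\<lambda>x\<in>X. a) x) 0) \<in> T"
      by (rule tribe_diff[OF tribe f const[OF 3]])
    from tribe_sets_support[OF tribe this]
    have "{x \<in> X. 0 < (\<lambda>x\<in>X. max (f x - (\<lambda>x\<in>X. a) x) 0) x} \<in> sets \<S>" by simp
    also have "{x \<in> X. 0 < (\<lambda>x\<in>X. max (f x - (\<lambda>x\<in>X. a) x) 0) x} = {w \<in> space \<S>. a < f w}"
      by auto
    finally show ?thesis .
  qed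
qed

text \<open>The induction runs through nonnegative functions without an upper bound, of which the
  tribe knows nothing. With an arbitrary factor \<open>c\<close> such that
  \<open>c * u \<le> 1\<close>, every stage falls back into the tribe: in the scaling step the
  hypothesis is used at \<open>c * c'\<close>, and in the other steps the bound is inherited by
  summands and approximants.\<close>

lemma scaled_measurable_in_tribe:
  assumes "u \<in> borel_measurable \<S>" "\<And>x. 0 \<le> u x" "0 \<le> c" "\<And>x. x \<in> X \<Longrightarrow> c * u x \<le> 1"
  shows "(\<lambda>x\<in>X. c * u x) \<in> T"
  using assms(1-4)
proof (induction arbitrary: c rule: borel_measurable_induct_real)
  case (set A)
  then have A: "(\<lambda>x\<in>X. indicator A x) \<in> T" by (simp add: tribe_sets_def)
  \<comment> \<open>A multiple of an indicator is its minimum with a constant. The constant is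
    \<open>min c 1\<close> because \<open>c\<close> may exceed 1 when \<open>A\<close> is
    empty.\<close>
  have "(\<lambda>x\<in>X. min ((\<lambda>x\<in>X. min c 1) x) ((\<lambda>x\<in>X. indicator A x) x)) \<in> T" (is "?h \<in> _")
    by (rule tribe_min[OF tribe const A]) (use set in auto)
  also have "?h = (\<lambda>x\<in>X. c * indicator A x)"
    using set by (force simp: fun_eq_iff indicator_def)
  finally show ?case .
next
  case (mult u c')
  show ?case using mult.IH[of "c * c'"] mult.hyps mult.prems by (simp add: mult.assoc)
next
  case (add u v)
  have le: "c * u x \<le> 1" "c * v x \<le> 1" if "x \<in> X" for x
    using add.prems(2)[OF that] mult_nonneg_nonneg[OF add.prems(1) add.hyps(2)[of x]]
      mult_nonneg_nonneg[OF add.prems(1) add.hyps(4)[of x]]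
    unfolding distrib_left by linarith+
  have "(\<lambda>x\<in>X. min ((\<lambda>x\<in>X. c * v x) x + (\<lambda>x\<in>X. c * u x) x) 1) \<in> T" (is "?h \<in> _")
    using add.IH add.prems(1) le by (intro tribe_plus[OF tribe]) auto
  also have "?h = (\<lambda>x\<in>X. c * (v x + u x))"
    using add.prems(2) by (auto simp: fun_eq_iff distrib_left)
  finally show ?case .
next
  case (seq U)
  have mono: "c * U i x \<le> c * U j x" if "i \<le> j" for i j x
    using seq.hyps(3) seq.prems(1) that by (auto simp: incseq_def le_fun_def intro!: mult_left_mono)
  have lim: "(\<lambda>i. c * U i x) \<longlonglongrightarrow> c * u x" if "x \<in> X" for x
    using seq.hyps(4)[of x] that by (auto intro: tendsto_mult_left)
  have "c * U i x \<le> c * u x" if "x \<in> X" for i x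
    using mono by (intro incseq_le[OF _ lim[OF that]]) (auto simp: incseq_def)
  then have mem: "(\<lambda>x\<in>X. c * U i x) \<in> T" for i
    using seq.prems by (intro seq.IH) (auto intro: order_trans)
  show ?case
    by (rule tribe_lim[where f = "\<lambda>i. \<lambda>x\<in>X. c * U i x", OF tribe mem]) (use mono lim in \<open>auto simp: incseq_def\<close>)
qed

text \<open>The direction from right to left is what later admits a clipped conditional expectation
  into \<open>Ns\<close>.\<close>

lemma in_tribe_iff:
  "f \<in> T \<longleftrightarrow> f \<in> extensional X \<and> f \<in> X \<rightarrow> {0..1} \<and> f \<in> borel_measurable \<S>"
proof
  assume "f \<in> T"
  then show "f \<in> extensional X \<and> f \<in> X \<rightarrow> {0..1} \<and> f \<in> borel_measurable \<S>"
    using tribe_extensional[OF tribe] tribe_range[OF tribe] measurable by auto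
next
  assume f: "f \<in> extensional X \<and> f \<in> X \<rightarrow> {0..1} \<and> f \<in> borel_measurable \<S>"
  \<comment> \<open>The induction asks for nonnegativity everywhere, while \<open>f\<close> is
    uncontrolled outside \<open>X\<close>; the positive part repairs this without changing
    \<open>f\<close> on \<open>X\<close>.\<close>
  have "(\<lambda>x\<in>X. 1 * max (f x) 0) \<in> T"
    by (rule scaled_measurable_in_tribe) (use f in auto)
  moreover have "(\<lambda>x\<in>X. 1 * max (f x) 0) = f"
    using f by (force simp: fun_eq_iff extensional_def)
  ultimately show "f \<in> T" by simp
qed

end

section \<open>Integral representation of \<sigma>-additive states on a tribe\<close>

text \<open>To be used with \<open>L f = m (\<eta> f)\<close>. The bound in \<open>L_add\<close>
  says that the sum is an orthosum, and \<open>L_lim\<close> is \<sigma>-additivity for pointwise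
  increasing limits.\<close>

locale tribe_state = const_tribe X T for X :: "'x set" and T +
  fixes L :: "('x \<Rightarrow> real) \<Rightarrow> real"
  assumes L_nonneg: "f \<in> T \<Longrightarrow> 0 \<le> L f"
    and L_add: "f \<in> T \<Longrightarrow> g \<in> T \<Longrightarrow> (\<And>x. x \<in> X \<Longrightarrow> f x + g x \<le> 1) \<Longrightarrow>
      L (\<lambda>x\<in>X. f x + g x) = L f + L g"
    and L_lim: "(\<And>n. F n \<in> T) \<Longrightarrow> g \<in> T \<Longrightarrow> (\<And>x. x \<in> X \<Longrightarrow> incseq (\<lambda>n. F n x)) \<Longrightarrow>
      (\<And>x. x \<in> X \<Longrightarrow> (\<lambda>n. F n x) \<longlonglongrightarrow> g x) \<Longrightarrow> (\<lambda>n::nat. L (F n)) \<longlonglongrightarrow> L g"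
    and L_one: "L (\<lambda>x\<in>X. 1) = 1"
begin

definition P :: "'x measure" where
  "P = measure_of X (tribe_sets X T) (\<lambda>A. ennreal (L (\<lambda>x\<in>X. indicator A x)))"

lemma space_P [simp]: "space P = X"
  unfolding P_def by (rule space_measure_of) (auto simp: tribe_sets_def)

lemma sets_P: "sets P = sets \<S>"
  unfolding P_def sets_\<S>
  by (rule sigma_algebra.sets_measure_of_eq[OF sigma_algebra_tribe_sets[OF tribe]])

lemma measurable_P_iff: "f \<in> borel_measurable P \<longleftrightarrow> f \<in> borel_measurable \<S>"
  by (simp add: measurable_def sets_P)

lemma indicator_in_tribe: "A \<in> tribe_sets X T \<Longrightarrow> (\<lambda>x\<in>X. indicator A x) \<in> T"
  by (simp add: tribe_sets_def)

lemma L_zero: "L (\<lambda>x\<in>X. 0) = 0"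
  using L_add[OF tribe_zero[OF tribe] tribe_zero[OF tribe]] by (simp cong: restrict_cong)

text \<open>Disjointness keeps sums of indicators below 1, so \<open>L_add\<close> gives finite
  additivity, and \<open>L_lim\<close> along the partial unions makes it countable.\<close>

lemma emeasure_P:
  assumes A: "A \<in> tribe_sets X T"
  shows "emeasure P A = ennreal (L (\<lambda>x\<in>X. indicator A x))"
  unfolding P_def
proof (rule emeasure_measure_of_sigma[OF sigma_algebra_tribe_sets[OF tribe] _ _ A])
  show "positive (tribe_sets X T) (\<lambda>A. ennreal (L (\<lambda>x\<in>X. indicator A x)))"
    by (simp add: positive_def L_zero)
  show "countably_additive (tribe_sets X T) (\<lambda>A. ennreal (L (\<lambda>x\<in>X. indicator A x)))"
    unfolding countably_additive_def
  proof (intro allI impI)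
    fix A :: "nat \<Rightarrow> 'x set"
    assume A: "range A \<subseteq> tribe_sets X T" and disj: "disjoint_family A"
      and un: "(\<Union>i. A i) \<in> tribe_sets X T"
    let ?L = "\<lambda>A. L (\<lambda>x\<in>X. indicator A x)"
    have fin: "(\<Union>i<n. A i) \<in> tribe_sets X T" for n
      using A by (simp flip: sets_\<S>)
    have sum: "?L (\<Union>i<n. A i) = (\<Sum>i<n. ?L (A i))" for n
    proof (induction n)
      case 0
      then show ?case using L_zero by (simp add: restrict_def)
    next
      case (Suc n)
      have dj: "(\<Union>i<n. A i) \<inter> A n = {}"
        using disjoint_family_onD[OF disj, of _ n] by fastforce
      have "?L (\<Union>i<Suc n. A i) =
          L (\<lambda>x\<in>X. (\<lambda>x\<in>X. indicator (\<Union>i<n. A i) x) x + (\<lambda>x\<in>X. indicator (A n) x) x)"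
        using dj by (intro arg_cong[where f = L]) (auto simp: fun_eq_iff indicator_def less_Suc_eq)
      also have "\<dots> = ?L (\<Union>i<n. A i) + ?L (A n)"
        using A dj by (intro L_add indicator_in_tribe fin) (auto simp: indicator_def)
      finally show ?case by (simp only: sum.lessThan_Suc Suc)
    qed
    have "(\<lambda>n. ?L (\<Union>i<n. A i)) \<longlonglongrightarrow> ?L (\<Union>i. A i)"
    proof (rule L_lim[OF indicator_in_tribe[OF fin] indicator_in_tribe[OF un]])
      fix x assume x: "x \<in> X"
      show "incseq (\<lambda>n. (\<lambda>x\<in>X. indicator (\<Union>i<n. A i) x :: real) x)"
        using x by (auto simp: incseq_def indicator_def)
      show "(\<lambda>n. (\<lambda>x\<in>X. indicator (\<Union>i<n. A i) x) x) \<longlonglongrightarrow> (\<lambda>x\<in>X. indicator (\<Union>i. A i) x :: real) x"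
        using x by (simp add: LIMSEQ_indicator_UN)
    qed
    then have sums: "(\<lambda>i. ?L (A i)) sums ?L (\<Union>i. A i)"
      unfolding sums_def sum .
    have nn: "0 \<le> ?L (A i)" for i
      using A by (intro L_nonneg indicator_in_tribe) auto
    show "(\<Sum>i. ennreal (?L (A i))) = ennreal (?L (\<Union>i. A i))"
      using suminf_ennreal2[OF nn sums_summable[OF sums]] sums_unique[OF sums] by simp
  qed
qed

lemma prob_space_P: "prob_space P"
proof
  have "X \<in> tribe_sets X T"
    using sets.top[of \<S>] by simp
  from emeasure_P[OF this] show "emeasure P (space P) = 1"
    using L_one by (simp add: restrict_def indicator_def cong: if_cong)
qed

lemma integrable_P:
  assumes "f \<in> T"
  shows "integrable P f"
proof -
  interpret prob_space P by (rule prob_space_P)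
  show ?thesis
    using measurable[OF assms] tribe_range[OF tribe assms] measurable_P_iff
    by (intro integrable_const_bound[of _ 1]) auto
qed

text \<open>Homogeneity is not part of being a state; it comes from the additive and nonnegative map
  \<open>r \<mapsto> L (r * indicator A)\<close>, which must be linear.\<close>

lemma L_scale_indicator:
  assumes A: "A \<in> tribe_sets X T" and r: "r \<in> {0..1}"
  shows "L (\<lambda>x\<in>X. r * indicator A x) = r * L (\<lambda>x\<in>X. indicator A x)"
proof -
  have mem: "(\<lambda>x\<in>X. s * indicator A x) \<in> T" if "s \<in> {0..1}" for s
    using that A by (intro scaled_measurable_in_tribe) (auto intro!: borel_measurable_indicator split: split_indicator)
  have "L (\<lambda>x\<in>X. r * indicator A x) = r * L (\<lambda>x\<in>X. 1 * indicator A x)"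
  proof (rule additive_unit_interval_linear[where \<phi> = "\<lambda>r. L (\<lambda>x\<in>X. r * indicator A x)", OF _ _ r])
    fix r s :: real assume rs: "r \<in> {0..1}" "s \<in> {0..1}" "r + s \<le> 1"
    have "L (\<lambda>x\<in>X. (\<lambda>x\<in>X. r * indicator A x) x + (\<lambda>x\<in>X. s * indicator A x) x) =
        L (\<lambda>x\<in>X. r * indicator A x) + L (\<lambda>x\<in>X. s * indicator A x)"
      using rs by (intro L_add mem) (auto simp: indicator_def)
    then show "L (\<lambda>x\<in>X. (r + s) * indicator A x) =
        L (\<lambda>x\<in>X. r * indicator A x) + L (\<lambda>x\<in>X. s * indicator A x)"
      by (simp add: distrib_right cong: restrict_cong)
  qed (use mem L_nonneg in auto)
  then show ?thesis by simp
qed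

text \<open>Both sides agree on multiples of indicators, are additive, and pass to increasing
  limits, the left one by \<open>L_lim\<close> and the right one by dominated convergence with bound
  1. The factor \<open>c\<close> keeps all arguments of \<open>L\<close> inside the tribe.\<close>

lemma L_scaled_eq_integral:
  assumes "u \<in> borel_measurable \<S>" "\<And>x. 0 \<le> u x" "0 \<le> c" "\<And>x. x \<in> X \<Longrightarrow> c * u x \<le> 1"
  shows "L (\<lambda>x\<in>X. c * u x) = (\<integral>x. c * u x \<partial>P)"
  using assms(1-4)
proof (induction arbitrary: c rule: borel_measurable_induct_real)
  case (set A)
  interpret prob_space P by (rule prob_space_P)
  have A: "A \<in> tribe_sets X T" using set by simp
  have AX: "A \<inter> X = A" using A by (auto simp: tribe_sets_def)
  have meas: "L (\<lambda>x\<in>X. indicator A x) = measure P A"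
    using emeasure_P[OF A] L_nonneg[OF indicator_in_tribe[OF A]] by (simp add: measure_def)
  have "(\<integral>x. c * indicator A x \<partial>P) = c * measure P A"
    using A AX by (simp add: sets_P)
  moreover have "L (\<lambda>x\<in>X. c * indicator A x) = c * measure P A"
  \<comment> \<open>A point of \<open>A\<close> is needed to conclude \<open>c \<le> 1\<close> from
    the bound on \<open>c * indicator A\<close>.\<close>
  proof (cases "A = {}")
    case True
    then show ?thesis by (simp add: L_zero)
  next
    case False
    then obtain x where "x \<in> A" by blast
    then have "c \<le> 1" using A set.prems(2)[of x] by (auto simp: tribe_sets_def)
    then show ?thesis using L_scale_indicator[OF A, of c] set.prems(1) meas by simp
  qed
  ultimately show ?case by (simp only:)
next
  case (mult u c')
  show ?case using mult.IH[of "c * c'"] mult.hyps mult.prems by (simp add: mult.assoc)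
next
  case (add u v)
  have le: "c * u x \<le> 1" "c * v x \<le> 1" if "x \<in> X" for x
    using add.prems(2)[OF that] mult_nonneg_nonneg[OF add.prems(1) add.hyps(2)[of x]]
      mult_nonneg_nonneg[OF add.prems(1) add.hyps(4)[of x]]
    unfolding distrib_left by linarith+
  have mem: "(\<lambda>x\<in>X. c * v x) \<in> T" "(\<lambda>x\<in>X. c * u x) \<in> T"
    using add.hyps add.prems(1) le by (auto intro!: scaled_measurable_in_tribe)
  have int: "integrable P (\<lambda>x. c * v x)" "integrable P (\<lambda>x. c * u x)"
    using integrable_P[OF mem(1)] integrable_P[OF mem(2)]
      Bochner_Integration.integrable_cong[OF refl, of P "\<lambda>x\<in>X. c * v x" "\<lambda>x. c * v x"]
      Bochner_Integration.integrable_cong[OF refl, of P "\<lambda>x\<in>X. c * u x" "\<lambda>x. c * u x"] by simp_all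
  have "L (\<lambda>x\<in>X. c * (v x + u x)) = L (\<lambda>x\<in>X. (\<lambda>x\<in>X. c * v x) x + (\<lambda>x\<in>X. c * u x) x)"
    by (simp add: distrib_left cong: restrict_cong)
  also have "\<dots> = L (\<lambda>x\<in>X. c * v x) + L (\<lambda>x\<in>X. c * u x)"
    using add.prems by (intro L_add mem) (auto simp: distrib_left)
  also have "\<dots> = (\<integral>x. c * v x \<partial>P) + (\<integral>x. c * u x \<partial>P)"
    by (simp only: add.IH(1)[OF add.prems(1) le(1)] add.IH(2)[OF add.prems(1) le(2)])
  also have "\<dots> = (\<integral>x. c * (v x + u x) \<partial>P)"
    using int by (simp add: distrib_left)
  finally show ?case .
next
  case (seq U)
  interpret prob_space P by (rule prob_space_P)
  have mono: "c * U i x \<le> c * U j x" if "i \<le> j" for i j x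
    using seq.hyps(3) seq.prems(1) that by (auto simp: incseq_def le_fun_def intro!: mult_left_mono)
  have lim: "(\<lambda>i. c * U i x) \<longlonglongrightarrow> c * u x" if "x \<in> X" for x
    using seq.hyps(4)[of x] that by (auto intro: tendsto_mult_left)
  have "c * U i x \<le> c * u x" if "x \<in> X" for i x
    using mono by (intro incseq_le[OF _ lim[OF that]]) (auto simp: incseq_def)
  then have le: "c * U i x \<le> 1" if "x \<in> X" for i x
    using seq.prems that by (auto intro: order_trans)
  have mem: "(\<lambda>x\<in>X. c * U i x) \<in> T" for i
    using seq.hyps seq.prems(1) le by (auto intro!: scaled_measurable_in_tribe)
  have "(\<lambda>x\<in>X. c * u x) \<in> T"
    by (rule tribe_lim[where f = "\<lambda>i. \<lambda>x\<in>X. c * U i x", OF tribe mem]) (use mono lim in \<open>auto simp: incseq_def\<close>)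
  then have 1: "(\<lambda>n. L (\<lambda>x\<in>X. c * U n x)) \<longlonglongrightarrow> L (\<lambda>x\<in>X. c * u x)"
    by (intro L_lim mem) (use mono lim in \<open>auto simp: incseq_def\<close>)
  have um: "(\<lambda>x. c * u x) \<in> borel_measurable P"
    using measurable[OF \<open>(\<lambda>x\<in>X. c * u x) \<in> T\<close>] measurable_cong[of P "\<lambda>x\<in>X. c * u x" "\<lambda>x. c * u x" borel]
    by (simp add: measurable_P_iff)
  have Um: "(\<lambda>x. c * U i x) \<in> borel_measurable P" for i
    unfolding measurable_P_iff using seq.hyps(1)[of i] by simp
  have bound: "AE x in P. norm (c * U i x) \<le> 1" for i
    using le mult_nonneg_nonneg[OF seq.prems(1) seq.hyps(2)] by (intro AE_I2) simp
  have "AE x in P. (\<lambda>i. c * U i x) \<longlonglongrightarrow> c * u x"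
    using lim by (intro AE_I2) simp
  then have "(\<lambda>n. \<integral>x. c * U n x \<partial>P) \<longlonglongrightarrow> (\<integral>x. c * u x \<partial>P)"
    using bound by (intro integral_dominated_convergence[OF um Um, where w = "\<lambda>_. 1"]) simp_all
  moreover have "L (\<lambda>x\<in>X. c * U n x) = (\<integral>x. c * U n x \<partial>P)" for n
    by (rule seq.IH[OF seq.prems(1) le])
  ultimately show ?case using 1 LIMSEQ_unique by (simp only:)
qed

lemma L_eq_integral:
  assumes f: "f \<in> T"
  shows "L f = (\<integral>x. f x \<partial>P)"
proof -
  note range = tribe_range[OF tribe f]
  have "L (\<lambda>x\<in>X. 1 * max (f x) 0) = (\<integral>x. 1 * max (f x) 0 \<partial>P)"
    by (rule L_scaled_eq_integral) (use measurable[OF f] range in auto)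
  moreover have "(\<lambda>x\<in>X. 1 * max (f x) 0) = f"
    using range tribe_extensional[OF tribe f] by (force simp: fun_eq_iff extensional_def)
  moreover have "(\<integral>x. 1 * max (f x) 0 \<partial>P) = (\<integral>x. f x \<partial>P)"
    using range by (intro Bochner_Integration.integral_cong) auto
  ultimately show ?thesis by simp
qed

end

section \<open>The Loomis--Sikorski representation\<close>

locale ls_setting =
  fixes M :: "('a, 'm) mv_algebra_scheme"
    and sc :: "real \<Rightarrow> 'a \<Rightarrow> 'a"
    and N :: "'a set"
    and m :: "'a \<Rightarrow> real"
    and Ms :: "(('a \<Rightarrow> real) \<Rightarrow> real) set"
    and \<eta> :: "(('a \<Rightarrow> real) \<Rightarrow> real) \<Rightarrow> 'a"
  assumes M: "sigma_mv_algebra M" "convex_structure M sc"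
    and N: "sigma_mv_subalgebra N M" "convex_sub sc N"
    and m: "mv_state M m" "mv_sigma_additive M m"
    and LS: "loomis_sikorski M Ms \<eta>"
begin

sublocale sigma_mv_algebra M by (rule M(1))

abbreviation "X \<equiv> ext_states M"
abbreviation "star \<equiv> mv_star M"

lemma one_closed: "mv_one M \<in> carrier M"
  unfolding mv_one_def by (intro neg_closed zero_closed)

lemma tribe_Ms: "tribe X Ms"
  and hom: "sigma_mv_hom (tribe_mv X Ms) M \<eta>"
  and \<eta>_onto: "\<eta> ` Ms = carrier M"
  using LS unfolding loomis_sikorski_def by blast+

lemma star_iff:
  "a \<in> carrier M \<Longrightarrow>
    f = star a \<longleftrightarrow> f \<in> Ms \<and> continuous_map (ext_top M) euclideanreal f \<and> \<eta> f = a"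
  using LS unfolding loomis_sikorski_def by blast

lemma star_in_Ms: "a \<in> carrier M \<Longrightarrow> star a \<in> Ms"
  and star_continuous: "a \<in> carrier M \<Longrightarrow> continuous_map (ext_top M) euclideanreal (star a)"
  and \<eta>_star: "a \<in> carrier M \<Longrightarrow> \<eta> (star a) = a"
  using star_iff by blast+

lemma \<eta>_closed: "f \<in> Ms \<Longrightarrow> \<eta> f \<in> carrier M"
  using \<eta>_onto by blast

lemma \<eta>_zero: "\<eta> (\<lambda>\<omega>\<in>X. 0) = mv_zero M"
  and \<eta>_neg: "f \<in> Ms \<Longrightarrow> \<eta> (\<lambda>\<omega>\<in>X. 1 - f \<omega>) = mv_neg M (\<eta> f)"
  and \<eta>_plus: "f \<in> Ms \<Longrightarrow> g \<in> Ms \<Longrightarrow> \<eta> (\<lambda>\<omega>\<in>X. min (f \<omega> + g \<omega>) 1) = mv_plus M (\<eta> f) (\<eta> g)"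
  using hom unfolding sigma_mv_hom_def tribe_mv_def by simp_all

lemma \<eta>_sup:
  "S \<subseteq> carrier (tribe_mv X Ms) \<Longrightarrow> S \<noteq> {} \<Longrightarrow> countable S \<Longrightarrow> mv_is_sup (tribe_mv X Ms) S s \<Longrightarrow>
    mv_is_sup M (\<eta> ` S) (\<eta> s)"
  using hom unfolding sigma_mv_hom_def by simp

lemma \<eta>_one: "\<eta> (\<lambda>\<omega>\<in>X. 1) = mv_one M"
  using \<eta>_neg[OF tribe_zero[OF tribe_Ms]] by (simp add: mv_one_def \<eta>_zero cong: restrict_cong)

lemma topspace_ext_top: "topspace (ext_top M) = X"
  by (auto simp: ext_top_def ext_states_def PiE_def)

text \<open>\<open>star\<close> of an element is the only continuous function of \<open>Ms\<close>
  above it, so it suffices that the right-hand side is continuous and has the correct image under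
  \<open>\<eta>\<close>.\<close>

lemma star_neg:
  assumes a: "a \<in> carrier M"
  shows "star (mv_neg M a) = (\<lambda>\<omega>\<in>X. 1 - star a \<omega>)"
proof -
  have "continuous_map (ext_top M) euclideanreal (\<lambda>\<omega>. 1 - star a \<omega>)"
    by (intro continuous_intros star_continuous a)
  then have "continuous_map (ext_top M) euclideanreal (\<lambda>\<omega>\<in>X. 1 - star a \<omega>)"
    by (rule continuous_map_eq) (simp add: topspace_ext_top)
  then show ?thesis
    using a by (metis star_iff \<eta>_neg \<eta>_star neg_closed star_in_Ms tribe_compl[OF tribe_Ms])
qed

text \<open>A state is additive only on orthogonal pairs. That an extremal state respects the
  truncated sum of arbitrary elements is read off from the uniqueness of the continuous
  representative.\<close>

lemma star_plus:
  assumes a: "a \<in> carrier M" and b: "b \<in> carrier M"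
  shows "star (mv_plus M a b) = (\<lambda>\<omega>\<in>X. min (star a \<omega> + star b \<omega>) 1)"
proof -
  have "continuous_map (ext_top M) euclideanreal (\<lambda>\<omega>. min (star a \<omega> + star b \<omega>) 1)"
    by (intro continuous_intros star_continuous a b)
  then have "continuous_map (ext_top M) euclideanreal (\<lambda>\<omega>\<in>X. min (star a \<omega> + star b \<omega>) 1)"
    by (rule continuous_map_eq) (simp add: topspace_ext_top)
  moreover have "\<eta> (\<lambda>\<omega>\<in>X. min (star a \<omega> + star b \<omega>) 1) = mv_plus M a b"
    using a b by (simp add: \<eta>_plus star_in_Ms \<eta>_star)
  ultimately have "(\<lambda>\<omega>\<in>X. min (star a \<omega> + star b \<omega>) 1) = star (mv_plus M a b)"
    unfolding star_iff[OF plus_closed[OF a b]]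
    using tribe_plus[OF tribe_Ms star_in_Ms[OF a] star_in_Ms[OF b]] by blast
  then show ?thesis by simp
qed

lemma star_zero: "star (mv_zero M) = (\<lambda>\<omega>\<in>X. 0)"
proof -
  have "continuous_map (ext_top M) euclideanreal (\<lambda>\<omega>. 0)"
    by simp
  then have "continuous_map (ext_top M) euclideanreal (\<lambda>\<omega>\<in>X. 0)"
    by (rule continuous_map_eq) (simp add: topspace_ext_top)
  then have "(\<lambda>\<omega>\<in>X. 0) = star (mv_zero M)"
    unfolding star_iff[OF zero_closed] using tribe_zero[OF tribe_Ms] \<eta>_zero by blast
  then show ?thesis by simp
qed

lemma star_inj: "a \<in> carrier M \<Longrightarrow> b \<in> carrier M \<Longrightarrow> star a = star b \<Longrightarrow> a = b"
  by (metis \<eta>_star)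

lemma star_range: "a \<in> carrier M \<Longrightarrow> \<omega> \<in> X \<Longrightarrow> 0 \<le> star a \<omega> \<and> star a \<omega> \<le> 1"
  using tribe_range[OF tribe_Ms star_in_Ms] .

lemma orth_star:
  assumes a: "a \<in> carrier M" and c: "c \<in> carrier M" and orth: "mv_orth M a c" and \<omega>: "\<omega> \<in> X"
  shows "star a \<omega> + star c \<omega> \<le> 1" "star (mv_plus M a c) \<omega> = star a \<omega> + star c \<omega>"
proof -
  have "star (mv_times M a c) \<omega> = 1 - min (1 - star a \<omega> + (1 - star c \<omega>)) 1"
    unfolding mv_times_def using a c \<omega>
    by (simp add: star_neg star_plus neg_closed plus_closed)
  moreover have "star (mv_times M a c) \<omega> = 0"
    using orth \<omega> by (simp add: mv_orth_def star_zero)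
  ultimately show le: "star a \<omega> + star c \<omega> \<le> 1" by (simp add: min_def split: if_splits)
  then show "star (mv_plus M a c) \<omega> = star a \<omega> + star c \<omega>"
    using a c \<omega> by (simp add: star_plus)
qed

text \<open>Cancellation is inherited from the reals: on an orthosum \<open>star\<close> is additive
  without truncation, hence \<open>star c\<close> is the pointwise difference, and
  \<open>star\<close> is injective.\<close>

lemma mv_minus_eqI:
  assumes a: "a \<in> carrier M" and c: "c \<in> carrier M" and sum: "osum (mv_effect M) a c = Some b"
  shows "mv_minus M b a = c"
  unfolding mv_minus_def
proof (rule the_equality)
  show "c \<in> carrier M \<and> osum (mv_effect M) a c = Some b" using c sum by simp
  fix d assume d: "d \<in> carrier M \<and> osum (mv_effect M) a d = Some b"
  have "mv_orth M a c" "mv_orth M a d" "mv_plus M a c = mv_plus M a d"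
    using d sum by (auto simp: mv_effect_def split: if_splits)
  then have "star d \<omega> = star c \<omega>" if "\<omega> \<in> X" for \<omega>
    using orth_star(2)[OF a c _ that] orth_star(2)[OF a _ _ that, of d] d by simp
  then have "star d = star c"
    using extensionalityI[OF tribe_extensional[OF tribe_Ms star_in_Ms]
        tribe_extensional[OF tribe_Ms star_in_Ms]] c d by blast
  then show "d = c" using star_inj d c by blast
qed

section \<open>Operations, order and suprema of \<open>M\<close> on arbitrary
  representatives\<close>

lemma \<eta>_times:
  assumes f: "f \<in> Ms" and g: "g \<in> Ms"
  shows "mv_times M (\<eta> f) (\<eta> g) = \<eta> (\<lambda>\<omega>\<in>X. max (f \<omega> + g \<omega> - 1) 0)"
proof -
  have "mv_times M (\<eta> f) (\<eta> g) =
      \<eta> (\<lambda>\<omega>\<in>X. 1 - (\<lambda>\<omega>\<in>X. min ((\<lambda>\<omega>\<in>X. 1 - f \<omega>) \<omega> + (\<lambda>\<omega>\<in>X. 1 - g \<omega>) \<omega>) 1) \<omega>)"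
    unfolding mv_times_def using f g
    by (simp only: \<eta>_neg \<eta>_plus tribe_compl[OF tribe_Ms] tribe_plus[OF tribe_Ms])
  also have "(\<lambda>\<omega>\<in>X. 1 - (\<lambda>\<omega>\<in>X. min ((\<lambda>\<omega>\<in>X. 1 - f \<omega>) \<omega> + (\<lambda>\<omega>\<in>X. 1 - g \<omega>) \<omega>) 1) \<omega>) =
      (\<lambda>\<omega>\<in>X. max (f \<omega> + g \<omega> - 1) 0)"
    by (auto simp: fun_eq_iff)
  finally show ?thesis .
qed

lemma max_in_Ms:
  assumes f: "f \<in> Ms" and g: "g \<in> Ms"
  shows "(\<lambda>\<omega>\<in>X. max (f \<omega>) (g \<omega>)) \<in> Ms"
    and \<eta>_max: "mv_join M (\<eta> f) (\<eta> g) = \<eta> (\<lambda>\<omega>\<in>X. max (f \<omega>) (g \<omega>))"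
proof -
  note range = tribe_range[OF tribe_Ms f] tribe_range[OF tribe_Ms g]
  let ?h = "\<lambda>\<omega>\<in>X. min ((\<lambda>\<omega>\<in>X. 1 - (\<lambda>\<omega>\<in>X. min ((\<lambda>\<omega>\<in>X. 1 - f \<omega>) \<omega> + g \<omega>) 1) \<omega>) \<omega> + g \<omega>) 1"
  have eq: "?h = (\<lambda>\<omega>\<in>X. max (f \<omega>) (g \<omega>))"
    using range by (force simp: fun_eq_iff min_def max_def)
  have "?h \<in> Ms" by (intro tribe_compl[OF tribe_Ms] tribe_plus[OF tribe_Ms] f g)
  then show "(\<lambda>\<omega>\<in>X. max (f \<omega>) (g \<omega>)) \<in> Ms" by (simp only: eq)
  have "mv_join M (\<eta> f) (\<eta> g) = \<eta> ?h"
    unfolding mv_join_def using f g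
    by (simp only: \<eta>_neg \<eta>_plus tribe_compl[OF tribe_Ms] tribe_plus[OF tribe_Ms])
  then show "mv_join M (\<eta> f) (\<eta> g) = \<eta> (\<lambda>\<omega>\<in>X. max (f \<omega>) (g \<omega>))" by (simp only: eq)
qed

lemma \<eta>_min:
  assumes f: "f \<in> Ms" and g: "g \<in> Ms"
  shows "mv_meet M (\<eta> f) (\<eta> g) = \<eta> (\<lambda>\<omega>\<in>X. min (f \<omega>) (g \<omega>))"
proof -
  have "mv_meet M (\<eta> f) (\<eta> g) =
      \<eta> (\<lambda>\<omega>\<in>X. 1 - (\<lambda>\<omega>\<in>X. max ((\<lambda>\<omega>\<in>X. 1 - f \<omega>) \<omega>) ((\<lambda>\<omega>\<in>X. 1 - g \<omega>) \<omega>)) \<omega>)"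
    unfolding mv_meet_def using f g
    by (simp only: \<eta>_neg[symmetric] \<eta>_max tribe_compl[OF tribe_Ms] max_in_Ms)
  also have "(\<lambda>\<omega>\<in>X. 1 - (\<lambda>\<omega>\<in>X. max ((\<lambda>\<omega>\<in>X. 1 - f \<omega>) \<omega>) ((\<lambda>\<omega>\<in>X. 1 - g \<omega>) \<omega>)) \<omega>) =
      (\<lambda>\<omega>\<in>X. min (f \<omega>) (g \<omega>))"
    by (auto simp: fun_eq_iff)
  finally show ?thesis .
qed

lemma \<eta>_osum:
  assumes f: "f \<in> Ms" and g: "g \<in> Ms" and le: "\<And>\<omega>. \<omega> \<in> X \<Longrightarrow> f \<omega> + g \<omega> \<le> 1"
  shows "osum (mv_effect M) (\<eta> f) (\<eta> g) = Some (\<eta> (\<lambda>\<omega>\<in>X. f \<omega> + g \<omega>))"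
proof -
  have 1: "(\<lambda>\<omega>\<in>X. max (f \<omega> + g \<omega> - 1) 0) = (\<lambda>\<omega>\<in>X. 0)"
    and 2: "(\<lambda>\<omega>\<in>X. min (f \<omega> + g \<omega>) 1) = (\<lambda>\<omega>\<in>X. f \<omega> + g \<omega>)"
    using le by (auto simp: fun_eq_iff)
  show ?thesis
    using \<eta>_times[OF f g] \<eta>_plus[OF f g] unfolding 1 2
    by (simp add: mv_effect_def mv_orth_def \<eta>_zero)
qed

text \<open>Pointwise, \<open>min f g + \<bar>f - g\<bar> = max f g \<le> 1\<close>. So the absolute
  difference is an orthogonal complement of the meet in the join, which identifies the difference of
  the two.\<close>

lemma \<eta>_symdiff:
  assumes f: "f \<in> Ms" and g: "g \<in> Ms"
  shows "mv_symdiff M (\<eta> f) (\<eta> g) = \<eta> (\<lambda>\<omega>\<in>X. \<bar>f \<omega> - g \<omega>\<bar>)"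
proof -
  let ?i = "\<lambda>\<omega>\<in>X. min (f \<omega>) (g \<omega>)" and ?d = "\<lambda>\<omega>\<in>X. \<bar>f \<omega> - g \<omega>\<bar>"
  have i: "?i \<in> Ms" and d: "?d \<in> Ms"
    by (intro tribe_min[OF tribe_Ms] tribe_absdiff[OF tribe_Ms] f g)+
  have "osum (mv_effect M) (\<eta> ?i) (\<eta> ?d) = Some (\<eta> (\<lambda>\<omega>\<in>X. ?i \<omega> + ?d \<omega>))"
    using tribe_range[OF tribe_Ms f] tribe_range[OF tribe_Ms g]
    by (intro \<eta>_osum[OF i d]) (auto simp: min_def abs_if)
  also have "(\<lambda>\<omega>\<in>X. ?i \<omega> + ?d \<omega>) = (\<lambda>\<omega>\<in>X. max (f \<omega>) (g \<omega>))"
    by (auto simp: fun_eq_iff min_def max_def abs_if)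
  finally show ?thesis
    unfolding mv_symdiff_def \<eta>_max[OF f g] \<eta>_min[OF f g]
    by (rule mv_minus_eqI[OF \<eta>_closed[OF i] \<eta>_closed[OF d]])
qed

lemma \<eta>_mono:
  assumes f: "f \<in> Ms" and g: "g \<in> Ms" and le: "\<And>\<omega>. \<omega> \<in> X \<Longrightarrow> f \<omega> \<le> g \<omega>"
  shows "le (mv_order M) (\<eta> f) (\<eta> g)"
proof -
  have "mv_plus M (mv_neg M (\<eta> f)) (\<eta> g) = \<eta> (\<lambda>\<omega>\<in>X. min ((\<lambda>\<omega>\<in>X. 1 - f \<omega>) \<omega> + g \<omega>) 1)"
    using f g by (simp only: \<eta>_neg \<eta>_plus tribe_compl[OF tribe_Ms])
  also have "(\<lambda>\<omega>\<in>X. min ((\<lambda>\<omega>\<in>X. 1 - f \<omega>) \<omega> + g \<omega>) 1) = (\<lambda>\<omega>\<in>X. 1)"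
    using le by (auto simp: fun_eq_iff)
  finally show ?thesis unfolding mv_order_def \<eta>_one by simp
qed

lemma tribe_mv_le_iff:
  "le (mv_order (tribe_mv X Ms)) f g \<longleftrightarrow> (\<forall>\<omega>\<in>X. f \<omega> \<le> g \<omega>)"
proof -
  have "le (mv_order (tribe_mv X Ms)) f g \<longleftrightarrow>
      (\<lambda>\<omega>\<in>X. min ((\<lambda>\<omega>\<in>X. 1 - f \<omega>) \<omega> + g \<omega>) 1) = (\<lambda>\<omega>\<in>X. 1 - (\<lambda>\<omega>\<in>X. 0) \<omega>)"
    by (simp add: mv_order_def tribe_mv_def mv_one_def)
  also have "\<dots> \<longleftrightarrow> (\<forall>\<omega>\<in>X. min ((1 - f \<omega>) + g \<omega>) 1 = 1)"
    by (auto simp: fun_eq_iff)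
  also have "\<dots> \<longleftrightarrow> (\<forall>\<omega>\<in>X. f \<omega> \<le> g \<omega>)"
    by (auto simp: min_def split: if_splits)
  finally show ?thesis .
qed

text \<open>A pointwise increasing limit is the least upper bound inside the tribe, and
  \<open>\<eta>\<close> preserves countable suprema. The tribe is essential here: such a limit of
  functions \<open>star a\<close> may differ from \<open>star\<close> of the supremum on a meager
  set.\<close>

lemma \<eta>_lim_is_sup:
  assumes F: "\<And>n::nat. F n \<in> Ms" and g: "g \<in> Ms"
    and inc: "\<And>\<omega>. \<omega> \<in> X \<Longrightarrow> incseq (\<lambda>n. F n \<omega>)"
    and lim: "\<And>\<omega>. \<omega> \<in> X \<Longrightarrow> (\<lambda>n. F n \<omega>) \<longlonglongrightarrow> g \<omega>"
  shows "mv_is_sup M (range (\<lambda>n. \<eta> (F n))) (\<eta> g)"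
proof -
  have carr: "carrier (mv_order (tribe_mv X Ms)) = Ms"
    by (simp add: mv_order_def tribe_mv_def)
  have "mv_is_sup (tribe_mv X Ms) (range F) g"
    unfolding mv_is_sup_def least_def Upper_def carr tribe_mv_le_iff
  proof (intro conjI ballI subsetI CollectI allI impI IntI)
    fix f \<omega> assume "f \<in> range F \<inter> Ms" "\<omega> \<in> X"
    then show "f \<omega> \<le> g \<omega>" using incseq_le[OF inc lim] by auto
  next
    fix h \<omega> assume "h \<in> {u. \<forall>x. x \<in> range F \<inter> Ms \<longrightarrow> (\<forall>\<omega>\<in>X. x \<omega> \<le> u \<omega>)} \<inter> Ms" "\<omega> \<in> X"
    then show "g \<omega> \<le> h \<omega>" using F by (intro LIMSEQ_le_const2[OF lim]) auto
  qed (use g in auto)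
  moreover have "range F \<subseteq> carrier (tribe_mv X Ms)"
    using F by (auto simp: tribe_mv_def)
  ultimately have "mv_is_sup M (\<eta> ` range F) (\<eta> g)"
    by (intro \<eta>_sup) simp_all
  then show ?thesis by (simp only: image_image)
qed

section \<open>The subalgebra \<open>N\<close>, its tribe, and the constants\<close>

lemma N_subset: "N \<subseteq> carrier M"
  and N_zero: "mv_zero M \<in> N"
  and N_neg: "a \<in> N \<Longrightarrow> mv_neg M a \<in> N"
  and N_plus: "a \<in> N \<Longrightarrow> b \<in> N \<Longrightarrow> mv_plus M a b \<in> N"
  using N(1) unfolding sigma_mv_subalgebra_def by simp_all

lemma N_sup: "A \<subseteq> N \<Longrightarrow> A \<noteq> {} \<Longrightarrow> countable A \<Longrightarrow> mv_is_sup M A s \<Longrightarrow> s \<in> N"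
  using N(1) unfolding sigma_mv_subalgebra_def by (elim conjE) simp

lemma N_carrier: "a \<in> N \<Longrightarrow> a \<in> carrier M"
  using N_subset by blast

abbreviation "Ns \<equiv> sub_star M N"

text \<open>Closure of \<open>N\<close> under countable suprema becomes closure under increasing
  limits. As this tribe contains \<open>star\<close> of all of \<open>N\<close>, it contains the
  generated tribe \<open>Ns\<close>, and therefore \<open>\<eta>\<close> maps \<open>Ns\<close> into
  \<open>N\<close>.\<close>

lemma tribe_preimage: "tribe X {f \<in> Ms. \<eta> f \<in> N}"
  unfolding tribe_def
proof (intro conjI ballI allI impI)
  show "{f \<in> Ms. \<eta> f \<in> N} \<subseteq> X \<rightarrow>\<^sub>E {0..1}"
    using tribe_PiE[OF tribe_Ms] by blast
  show "(\<lambda>x\<in>X. 0) \<in> {f \<in> Ms. \<eta> f \<in> N}"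
    by (simp add: tribe_zero[OF tribe_Ms] \<eta>_zero N_zero)
  show "(\<lambda>x\<in>X. 1 - f x) \<in> {f \<in> Ms. \<eta> f \<in> N}" if "f \<in> {f \<in> Ms. \<eta> f \<in> N}" for f
    using that by (simp add: tribe_compl[OF tribe_Ms] \<eta>_neg N_neg)
  show "(\<lambda>x\<in>X. min (f x + g x) 1) \<in> {f \<in> Ms. \<eta> f \<in> N}"
    if "f \<in> {f \<in> Ms. \<eta> f \<in> N}" "g \<in> {f \<in> Ms. \<eta> f \<in> N}" for f g
    using that by (simp add: tribe_plus[OF tribe_Ms] \<eta>_plus N_plus)
  fix f :: "nat \<Rightarrow> ('a \<Rightarrow> real) \<Rightarrow> real" and g
  assume *: "(\<forall>n. f n \<in> {f \<in> Ms. \<eta> f \<in> N}) \<and>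
    (\<forall>x\<in>X. incseq (\<lambda>n. f n x) \<and> (\<lambda>n. f n x) \<longlonglongrightarrow> g x) \<and> g \<in> extensional X"
  then have "restrict g X \<in> Ms" by (intro tribe_lim[OF tribe_Ms, of f]) auto
  then have g: "g \<in> Ms" using * by (simp add: extensional_restrict)
  have "\<eta> g \<in> N"
    by (rule N_sup[of "range (\<lambda>n. \<eta> (f n))"], use * in force, simp, simp,
        rule \<eta>_lim_is_sup) (use * g in auto)
  with g show "g \<in> {f \<in> Ms. \<eta> f \<in> N}" by simp
qed

lemma star_N_subset: "star ` N \<subseteq> {f \<in> Ms. \<eta> f \<in> N}"
  using N_carrier by (auto simp: star_in_Ms \<eta>_star)

lemma tribe_Ns: "tribe X Ns"
  unfolding sub_star_def by (rule tribe_generated[OF tribe_preimage star_N_subset])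

lemma Ns_subset: "Ns \<subseteq> {f \<in> Ms. \<eta> f \<in> N}"
  unfolding sub_star_def generated_tribe_def using tribe_preimage star_N_subset by blast

lemma Ns_Ms: "f \<in> Ns \<Longrightarrow> f \<in> Ms"
  and \<eta>_Ns: "f \<in> Ns \<Longrightarrow> \<eta> f \<in> N"
  using Ns_subset by blast+

lemma star_in_Ns: "a \<in> N \<Longrightarrow> star a \<in> Ns"
  unfolding sub_star_def generated_tribe_def by blast

lemma star_scaled_one:
  assumes r: "r \<in> {0..1}"
  shows "star (sc r (mv_one M)) = (\<lambda>\<omega>\<in>X. r)"
proof -
  have "\<omega> (sc r (mv_one M)) = r" if "\<omega> \<in> X" for \<omega>
  proof -
    have st: "mv_state M \<omega>" using that by (simp add: ext_states_def)
    have "\<omega> (sc r (mv_one M)) = r * \<omega> (sc 1 (mv_one M))"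
    proof (rule additive_unit_interval_linear[where \<phi> = "\<lambda>r. \<omega> (sc r (mv_one M))", OF _ _ r])
      show "0 \<le> \<omega> (sc r (mv_one M))" if "r \<in> {0..1}" for r
        using st M(2) one_closed that unfolding mv_state_def convex_structure_def by fastforce
      show "\<omega> (sc (r + s) (mv_one M)) = \<omega> (sc r (mv_one M)) + \<omega> (sc s (mv_one M))"
        if "r \<in> {0..1}" "s \<in> {0..1}" "r + s \<le> 1" for r s
        using st M(2) one_closed that unfolding mv_state_def convex_structure_def by metis
    qed
    moreover have "sc 1 (mv_one M) = mv_one M" "\<omega> (mv_one M) = 1"
      using st M(2) one_closed unfolding mv_state_def convex_structure_def by blast+
    ultimately show ?thesis by simp
  qed
  then show ?thesis unfolding mv_star_def by (auto simp: fun_eq_iff)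
qed

lemma const_in_Ns:
  assumes r: "r \<in> {0..1}"
  shows "(\<lambda>\<omega>\<in>X. r) \<in> Ns"
proof -
  have "mv_one M \<in> N" unfolding mv_one_def by (intro N_neg N_zero)
  then have "sc r (mv_one M) \<in> N" using N(2) r unfolding convex_sub_def by blast
  from star_in_Ns[OF this] show ?thesis by (simp only: star_scaled_one[OF r])
qed

text \<open>A pointwise sum bounded by 1 is sent by \<open>\<eta>\<close> to an orthosum, and an
  increasing limit to a supremum of an increasing sequence; these are exactly the situations in
  which \<open>m\<close> is additive and continuous.\<close>

sublocale Ms: tribe_state X Ms "\<lambda>f. m (\<eta> f)"
proof
  show "tribe X Ms" by (rule tribe_Ms)
  show "(\<lambda>\<omega>\<in>X. r) \<in> Ms" if "r \<in> {0..1}" for r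
    using Ns_Ms[OF const_in_Ns[OF that]] .
  show "0 \<le> m (\<eta> f)" if "f \<in> Ms" for f
    using m(1) \<eta>_closed[OF that] unfolding mv_state_def by fastforce
  show "m (\<eta> (\<lambda>\<omega>\<in>X. f \<omega> + g \<omega>)) = m (\<eta> f) + m (\<eta> g)"
    if "f \<in> Ms" "g \<in> Ms" "\<And>\<omega>. \<omega> \<in> X \<Longrightarrow> f \<omega> + g \<omega> \<le> 1" for f g
    using m(1) \<eta>_osum[OF that] \<eta>_closed that(1,2) unfolding mv_state_def by blast
  show "m (\<eta> (\<lambda>\<omega>\<in>X. 1)) = 1"
    using m(1) unfolding \<eta>_one mv_state_def by blast
next
  fix F :: "nat \<Rightarrow> ('a \<Rightarrow> real) \<Rightarrow> real" and g
  assume F: "\<And>n. F n \<in> Ms" "g \<in> Ms" and inc: "\<And>\<omega>. \<omega> \<in> X \<Longrightarrow> incseq (\<lambda>n. F n \<omega>)"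
    and lim: "\<And>\<omega>. \<omega> \<in> X \<Longrightarrow> (\<lambda>n. F n \<omega>) \<longlonglongrightarrow> g \<omega>"
  have "le (mv_order M) (\<eta> (F n)) (\<eta> (F (Suc n)))" for n
    by (rule \<eta>_mono) (use F inc in \<open>auto intro: incseq_SucD\<close>)
  moreover have "mv_is_sup M (range (\<lambda>n. \<eta> (F n))) (\<eta> g)"
    by (rule \<eta>_lim_is_sup[OF F inc lim])
  ultimately show "(\<lambda>n. m (\<eta> (F n))) \<longlonglongrightarrow> m (\<eta> g)"
    using m(2)[unfolded mv_sigma_additive_def, THEN spec, THEN spec, of "\<lambda>n. \<eta> (F n)" "\<eta> g"]
      \<eta>_closed[OF F(1)] by simp
qed

sublocale Ns: const_tribe X Ns
  by unfold_locales (use tribe_Ns const_in_Ns in auto)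

section \<open>The quotient by the null ideal\<close>

abbreviation "P \<equiv> Ms.P"
abbreviation "cls \<equiv> mv_class M (mv_null_ideal M m)"
abbreviation "Mt \<equiv> mv_quotient M (mv_null_ideal M m)"

text \<open>Classes are indexed by functions of the tribe, so that functions without continuity,
  such as versions of conditional expectations, name classes directly.\<close>

definition K :: "(('a \<Rightarrow> real) \<Rightarrow> real) \<Rightarrow> 'a set" where
  "K f = cls (\<eta> f)"

lemma AE_in_X: "AE \<omega> in P. \<omega> \<in> X"
  using AE_space[of P] by simp

lemma AE_range: "f \<in> Ms \<Longrightarrow> AE \<omega> in P. 0 \<le> f \<omega> \<and> f \<omega> \<le> 1"
  using tribe_range[OF tribe_Ms, of f] by (intro AE_I2) simp

text \<open>The state of the symmetric difference is the L1-distance of the two functions, which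
  vanishes exactly for functions equal almost everywhere.\<close>

lemma mem_K_iff:
  assumes f: "f \<in> Ms" and g: "g \<in> Ms"
  shows "\<eta> g \<in> K f \<longleftrightarrow> (AE \<omega> in P. f \<omega> = g \<omega>)"
proof -
  let ?d = "\<lambda>\<omega>\<in>X. \<bar>f \<omega> - g \<omega>\<bar>"
  have d: "?d \<in> Ms" by (rule tribe_absdiff[OF tribe_Ms f g])
  have "\<eta> g \<in> K f \<longleftrightarrow> m (\<eta> ?d) = 0"
    using \<eta>_closed[OF g] \<eta>_closed[OF d]
    by (simp only: K_def mv_class_def mv_null_ideal_def \<eta>_symdiff[OF f g] mem_Collect_eq simp_thms)
  also have "\<dots> \<longleftrightarrow> (\<integral>\<omega>. ?d \<omega> \<partial>P) = 0"
    by (simp only: Ms.L_eq_integral[OF d])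
  also have "\<dots> \<longleftrightarrow> (AE \<omega> in P. ?d \<omega> = 0)"
    by (rule integral_nonneg_eq_0_iff_AE[OF Ms.integrable_P[OF d]])
      (use AE_range[OF d] in eventually_elim, simp)
  also have "\<dots> \<longleftrightarrow> (AE \<omega> in P. f \<omega> = g \<omega>)"
    by (rule AE_cong) simp
  finally show ?thesis .
qed

text \<open>As \<open>\<eta>\<close> is onto, classes can be compared on elements
  \<open>\<eta> h\<close> alone, and there transitivity of almost everywhere equality
  decides.\<close>

lemma K_eq_iff:
  assumes f: "f \<in> Ms" and g: "g \<in> Ms"
  shows "K f = K g \<longleftrightarrow> (AE \<omega> in P. f \<omega> = g \<omega>)"
proof
  assume "K f = K g"
  moreover have "\<eta> g \<in> K g" using mem_K_iff[OF g g] by simp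
  ultimately show "AE \<omega> in P. f \<omega> = g \<omega>" using mem_K_iff[OF f g] by simp
next
  assume fg: "AE \<omega> in P. f \<omega> = g \<omega>"
  have sub: "K f \<subseteq> carrier M" "K g \<subseteq> carrier M" by (auto simp: K_def mv_class_def)
  have "\<eta> h \<in> K f \<longleftrightarrow> \<eta> h \<in> K g" if h: "h \<in> Ms" for h
    unfolding mem_K_iff[OF f h] mem_K_iff[OF g h]
  proof
    assume "AE \<omega> in P. f \<omega> = h \<omega>"
    with fg show "AE \<omega> in P. g \<omega> = h \<omega>" by eventually_elim simp
  next
    assume "AE \<omega> in P. g \<omega> = h \<omega>"
    with fg show "AE \<omega> in P. f \<omega> = h \<omega>" by eventually_elim simp
  qed
  then have "a \<in> K f \<longleftrightarrow> a \<in> K g" if "a \<in> carrier M" for a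
    using that unfolding \<eta>_onto[symmetric] by auto
  with sub show "K f = K g" by blast
qed

lemma mem_KE:
  assumes "a \<in> K f" "f \<in> Ms"
  obtains g where "g \<in> Ms" "a = \<eta> g" "AE \<omega> in P. f \<omega> = g \<omega>"
proof -
  have "a \<in> carrier M" using assms(1) by (simp add: K_def mv_class_def)
  then obtain g where "g \<in> Ms" "a = \<eta> g" using \<eta>_onto by blast
  then show ?thesis using that assms mem_K_iff by blast
qed

lemma K_self: "f \<in> Ms \<Longrightarrow> \<eta> f \<in> K f"
  by (simp add: mem_K_iff)

lemma cls_eq_K: "a \<in> carrier M \<Longrightarrow> cls a = K (star a)"
  by (simp add: K_def \<eta>_star)

lemma carrier_Mt: "carrier Mt = K ` Ms"
  by (simp add: mv_quotient_def K_def flip: \<eta>_onto) (simp only: image_image K_def)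

lemma Mt_zero: "mv_zero Mt = K (\<lambda>\<omega>\<in>X. 0)"
  by (simp only: mv_quotient_def K_def \<eta>_zero mv_algebra.simps)

text \<open>All representatives of \<open>K f\<close> lead to the same class, so the union that
  defines the operation collapses to one set; \<open>K_self\<close> ensures that it is not an empty
  union.\<close>

lemma Mt_neg:
  assumes f: "f \<in> Ms"
  shows "mv_neg Mt (K f) = K (\<lambda>\<omega>\<in>X. 1 - f \<omega>)"
proof -
  have eq: "cls (mv_neg M a) = K (\<lambda>\<omega>\<in>X. 1 - f \<omega>)" if a: "a \<in> K f" for a
  proof -
    obtain g where g: "g \<in> Ms" "a = \<eta> g" "AE \<omega> in P. f \<omega> = g \<omega>"
      using a f by (rule mem_KE)
    have "cls (mv_neg M a) = K (\<lambda>\<omega>\<in>X. 1 - g \<omega>)"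
      by (simp only: K_def g(2) \<eta>_neg[OF g(1)])
    also have "\<dots> = K (\<lambda>\<omega>\<in>X. 1 - f \<omega>)"
      unfolding K_eq_iff[OF tribe_compl[OF tribe_Ms g(1)] tribe_compl[OF tribe_Ms f]]
      using g(3) by eventually_elim simp
    finally show ?thesis .
  qed
  have "mv_neg Mt (K f) = (\<Union>a\<in>K f. cls (mv_neg M a))"
    by (simp add: mv_quotient_def)
  also have "\<dots> = K (\<lambda>\<omega>\<in>X. 1 - f \<omega>)"
    using eq K_self[OF f] by blast
  finally show ?thesis .
qed

lemma Mt_plus:
  assumes f: "f \<in> Ms" and g: "g \<in> Ms"
  shows "mv_plus Mt (K f) (K g) = K (\<lambda>\<omega>\<in>X. min (f \<omega> + g \<omega>) 1)"
proof -
  have eq: "cls (mv_plus M a b) = K (\<lambda>\<omega>\<in>X. min (f \<omega> + g \<omega>) 1)"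
    if a: "a \<in> K f" and b: "b \<in> K g" for a b
  proof -
    obtain f' where f': "f' \<in> Ms" "a = \<eta> f'" "AE \<omega> in P. f \<omega> = f' \<omega>"
      using a f by (rule mem_KE)
    obtain g' where g': "g' \<in> Ms" "b = \<eta> g'" "AE \<omega> in P. g \<omega> = g' \<omega>"
      using b g by (rule mem_KE)
    have "cls (mv_plus M a b) = K (\<lambda>\<omega>\<in>X. min (f' \<omega> + g' \<omega>) 1)"
      by (simp only: K_def f'(2) g'(2) \<eta>_plus[OF f'(1) g'(1)])
    also have "\<dots> = K (\<lambda>\<omega>\<in>X. min (f \<omega> + g \<omega>) 1)"
      unfolding K_eq_iff[OF tribe_plus[OF tribe_Ms f'(1) g'(1)] tribe_plus[OF tribe_Ms f g]]
      using f'(3) g'(3) by eventually_elim simp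
    finally show ?thesis .
  qed
  have "mv_plus Mt (K f) (K g) = (\<Union>a\<in>K f. \<Union>b\<in>K g. cls (mv_plus M a b))"
    by (simp add: mv_quotient_def)
  also have "\<dots> = K (\<lambda>\<omega>\<in>X. min (f \<omega> + g \<omega>) 1)"
    using eq K_self[OF f] K_self[OF g] by blast
  finally show ?thesis .
qed

lemma Mt_one: "mv_one Mt = K (\<lambda>\<omega>\<in>X. 1)"
  unfolding mv_one_def Mt_zero Mt_neg[OF tribe_zero[OF tribe_Ms]]
  by (simp cong: restrict_cong)

section \<open>The quotient as an effect algebra\<close>

lemma Mt_orth:
  assumes f: "f \<in> Ms" and g: "g \<in> Ms"
  shows "mv_orth Mt (K f) (K g) \<longleftrightarrow> (AE \<omega> in P. f \<omega> + g \<omega> \<le> 1)"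
proof -
  let ?h = "\<lambda>\<omega>\<in>X. 1 - (\<lambda>\<omega>\<in>X. min ((\<lambda>\<omega>\<in>X. 1 - f \<omega>) \<omega> + (\<lambda>\<omega>\<in>X. 1 - g \<omega>) \<omega>) 1) \<omega>"
  have h: "?h \<in> Ms"
    by (intro tribe_compl[OF tribe_Ms] tribe_plus[OF tribe_Ms] f g)
  have "mv_times Mt (K f) (K g) = K ?h"
    unfolding mv_times_def using f g
    by (simp only: Mt_neg Mt_plus tribe_compl[OF tribe_Ms] tribe_plus[OF tribe_Ms])
  then have "mv_orth Mt (K f) (K g) \<longleftrightarrow> (AE \<omega> in P. ?h \<omega> = (\<lambda>\<omega>\<in>X. 0) \<omega>)"
    unfolding mv_orth_def Mt_zero by (simp only: K_eq_iff[OF h tribe_zero[OF tribe_Ms]])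
  also have "\<dots> \<longleftrightarrow> (AE \<omega> in P. f \<omega> + g \<omega> \<le> 1)"
    by (rule AE_cong) (auto simp: min_def)
  finally show ?thesis .
qed

text \<open>Representatives of orthogonal classes may add up to more than 1 on a null set. The
  truncation stays in the formula so that the sum remains in the tribe.\<close>

lemma Mt_osum_iff:
  assumes f: "f \<in> Ms" and g: "g \<in> Ms"
  shows "osum (mv_effect Mt) (K f) (K g) = Some C \<longleftrightarrow>
    (AE \<omega> in P. f \<omega> + g \<omega> \<le> 1) \<and> C = K (\<lambda>\<omega>\<in>X. min (f \<omega> + g \<omega>) 1)"
  using Mt_orth[OF f g] Mt_plus[OF f g] by (auto simp: mv_effect_def)

lemma carrier_effect: "carrier (mv_effect Mt) = K ` Ms"
  by (simp add: mv_effect_def carrier_Mt)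

lemma effect_algebra_Mt: "effect_algebra (mv_effect Mt)"
proof
  have zero: "ezero (mv_effect Mt) = K (\<lambda>\<omega>\<in>X. 0)" and one: "eone (mv_effect Mt) = K (\<lambda>\<omega>\<in>X. 1)"
    by (simp_all only: mv_effect_def effect_algebra.simps Mt_zero Mt_one)
  note one_Ms = tribe_one[OF tribe_Ms] and zero_Ms = tribe_zero[OF tribe_Ms]
  show "ezero (mv_effect Mt) \<in> carrier (mv_effect Mt)"
    unfolding zero carrier_effect using zero_Ms by (rule imageI)
  show "eone (mv_effect Mt) \<in> carrier (mv_effect Mt)"
    unfolding one carrier_effect using one_Ms by (rule imageI)
  fix A assume "A \<in> carrier (mv_effect Mt)"
  then obtain f where f: "f \<in> Ms" and A: "A = K f" unfolding carrier_effect by blast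
  show "\<exists>!B. B \<in> carrier (mv_effect Mt) \<and> osum (mv_effect Mt) A B = Some (eone (mv_effect Mt))"
  proof (rule ex1I)
    have c: "(\<lambda>\<omega>\<in>X. 1 - f \<omega>) \<in> Ms" by (rule tribe_compl[OF tribe_Ms f])
    have "AE \<omega> in P. f \<omega> + (\<lambda>\<omega>\<in>X. 1 - f \<omega>) \<omega> \<le> 1"
      using AE_in_X by eventually_elim simp
    moreover have "(\<lambda>\<omega>\<in>X. min (f \<omega> + (\<lambda>\<omega>\<in>X. 1 - f \<omega>) \<omega>) 1) = (\<lambda>\<omega>\<in>X. 1)"
      by (auto simp: fun_eq_iff)
    ultimately show "K (\<lambda>\<omega>\<in>X. 1 - f \<omega>) \<in> carrier (mv_effect Mt) \<and>
        osum (mv_effect Mt) A (K (\<lambda>\<omega>\<in>X. 1 - f \<omega>)) = Some (eone (mv_effect Mt))"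
      unfolding A one Mt_osum_iff[OF f c] carrier_effect using c by simp
    fix B assume "B \<in> carrier (mv_effect Mt) \<and>
        osum (mv_effect Mt) A B = Some (eone (mv_effect Mt))"
    then obtain g where g: "g \<in> Ms" and B: "B = K g"
      and sum: "osum (mv_effect Mt) A B = Some (eone (mv_effect Mt))"
      unfolding carrier_effect by blast
    have le: "AE \<omega> in P. f \<omega> + g \<omega> \<le> 1"
      and eq: "K (\<lambda>\<omega>\<in>X. 1) = K (\<lambda>\<omega>\<in>X. min (f \<omega> + g \<omega>) 1)"
      using sum unfolding A B one Mt_osum_iff[OF f g] by blast+
    have "AE \<omega> in P. (\<lambda>\<omega>\<in>X. 1) \<omega> = (\<lambda>\<omega>\<in>X. min (f \<omega> + g \<omega>) 1) \<omega>"
      using eq unfolding K_eq_iff[OF one_Ms tribe_plus[OF tribe_Ms f g]] .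
    with le AE_in_X have "AE \<omega> in P. g \<omega> = (\<lambda>\<omega>\<in>X. 1 - f \<omega>) \<omega>"
      by eventually_elim simp
    then show "B = K (\<lambda>\<omega>\<in>X. 1 - f \<omega>)" unfolding B K_eq_iff[OF g c] .
  qed
  show "A = ezero (mv_effect Mt)" if "osum (mv_effect Mt) A (eone (mv_effect Mt)) \<noteq> None"
  proof -
    have "AE \<omega> in P. f \<omega> + (\<lambda>\<omega>\<in>X. 1) \<omega> \<le> 1"
      using that Mt_osum_iff[OF f one_Ms] unfolding A one by blast
    with AE_in_X AE_range[OF f] have "AE \<omega> in P. f \<omega> = (\<lambda>\<omega>\<in>X. 0) \<omega>"
      by eventually_elim simp
    then show ?thesis unfolding A zero K_eq_iff[OF f zero_Ms] .
  qed
  fix B assume "B \<in> carrier (mv_effect Mt)"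
  then obtain g where g: "g \<in> Ms" and B: "B = K g" unfolding carrier_effect by blast
  show "osum (mv_effect Mt) A B = osum (mv_effect Mt) B A"
  proof -
    have "osum (mv_effect Mt) A B = Some C \<longleftrightarrow> osum (mv_effect Mt) B A = Some C" for C
      unfolding A B Mt_osum_iff[OF f g] Mt_osum_iff[OF g f] by (simp only: add.commute)
    then show ?thesis by (metis option.exhaust)
  qed
  show "C \<in> carrier (mv_effect Mt)" if "osum (mv_effect Mt) A B = Some C" for C
    using that tribe_plus[OF tribe_Ms f g] unfolding A B Mt_osum_iff[OF f g] carrier_effect by blast
  fix C D E assume "C \<in> carrier (mv_effect Mt)" and D: "osum (mv_effect Mt) A B = Some D"
    and E: "osum (mv_effect Mt) D C = Some E"
  then obtain h where h: "h \<in> Ms" and C: "C = K h" unfolding carrier_effect by blast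
  let ?p = "\<lambda>\<omega>\<in>X. min (f \<omega> + g \<omega>) 1" and ?q = "\<lambda>\<omega>\<in>X. min (g \<omega> + h \<omega>) 1"
  have p: "?p \<in> Ms" and q: "?q \<in> Ms" by (intro tribe_plus[OF tribe_Ms] f g h)+
  have fg: "AE \<omega> in P. f \<omega> + g \<omega> \<le> 1" and D': "D = K ?p"
    using D unfolding A B Mt_osum_iff[OF f g] by blast+
  have ph: "AE \<omega> in P. ?p \<omega> + h \<omega> \<le> 1" and E': "E = K (\<lambda>\<omega>\<in>X. min (?p \<omega> + h \<omega>) 1)"
    using E unfolding D' C Mt_osum_iff[OF p h] by blast+
  \<comment> \<open>A single almost sure event on which none of the truncations in the associative
    law is active.\<close>
  have fgh: "AE \<omega> in P. \<omega> \<in> X \<and> f \<omega> + g \<omega> + h \<omega> \<le> 1 \<and> 0 \<le> f \<omega> \<and> 0 \<le> g \<omega> \<and> 0 \<le> h \<omega>"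
    using fg ph AE_in_X AE_range[OF f] AE_range[OF g] AE_range[OF h] by eventually_elim simp
  have "osum (mv_effect Mt) B C = Some (K ?q)"
    unfolding B C Mt_osum_iff[OF g h] using fgh by (auto elim: eventually_mono)
  moreover have "osum (mv_effect Mt) A (K ?q) = Some E"
    unfolding A E' Mt_osum_iff[OF f q]
  proof
    show "AE \<omega> in P. f \<omega> + ?q \<omega> \<le> 1" using fgh by eventually_elim simp
    show "K (\<lambda>\<omega>\<in>X. min (?p \<omega> + h \<omega>) 1) = K (\<lambda>\<omega>\<in>X. min (f \<omega> + ?q \<omega>) 1)"
      unfolding K_eq_iff[OF tribe_plus[OF tribe_Ms p h] tribe_plus[OF tribe_Ms f q]]
      using fgh by eventually_elim simp
  qed
  ultimately show "\<exists>z. osum (mv_effect Mt) B C = Some z \<and> osum (mv_effect Mt) A z = Some E"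
    by blast
qed

text \<open>The truncated difference is the witness for the missing summand: it lies in the tribe
  even though \<open>f\<close> may exceed \<open>g\<close> on a null set.\<close>

lemma Mt_le_iff:
  assumes f: "f \<in> Ms" and g: "g \<in> Ms"
  shows "le (ea_order (mv_effect Mt)) (K f) (K g) \<longleftrightarrow> (AE \<omega> in P. f \<omega> \<le> g \<omega>)"
proof
  assume "le (ea_order (mv_effect Mt)) (K f) (K g)"
  then obtain h where h: "h \<in> Ms" and sum: "osum (mv_effect Mt) (K f) (K h) = Some (K g)"
    by (auto simp: ea_order_def carrier_effect)
  have "K g = K (\<lambda>\<omega>\<in>X. min (f \<omega> + h \<omega>) 1)"
    using sum unfolding Mt_osum_iff[OF f h] by blast
  then have "AE \<omega> in P. g \<omega> = (\<lambda>\<omega>\<in>X. min (f \<omega> + h \<omega>) 1) \<omega>"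
    unfolding K_eq_iff[OF g tribe_plus[OF tribe_Ms f h]] .
  then show "AE \<omega> in P. f \<omega> \<le> g \<omega>"
    using AE_in_X AE_range[OF f] AE_range[OF h] by eventually_elim simp
next
  assume le: "AE \<omega> in P. f \<omega> \<le> g \<omega>"
  let ?h = "\<lambda>\<omega>\<in>X. max (g \<omega> - f \<omega>) 0"
  have h: "?h \<in> Ms" by (rule tribe_diff[OF tribe_Ms g f])
  have "osum (mv_effect Mt) (K f) (K ?h) = Some (K g)"
    unfolding Mt_osum_iff[OF f h]
  proof
    show "AE \<omega> in P. f \<omega> + ?h \<omega> \<le> 1"
      using le AE_in_X AE_range[OF g] by eventually_elim simp
    show "K g = K (\<lambda>\<omega>\<in>X. min (f \<omega> + ?h \<omega>) 1)"
      unfolding K_eq_iff[OF g tribe_plus[OF tribe_Ms f h]]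
      using le AE_in_X AE_range[OF g] by eventually_elim simp
  qed
  then show "le (ea_order (mv_effect Mt)) (K f) (K g)"
    using h by (auto simp: ea_order_def carrier_effect)
qed

text \<open>Strongness speaks of an infimum given only by its universal property; comparing it with
  the class of the pointwise minimum, itself a lower bound, determines it.\<close>

lemma greatest_lower_bound_Mt:
  assumes f: "f \<in> Ms" and g: "g \<in> Ms"
    and i: "greatest (ea_order (mv_effect Mt)) i (Lower (ea_order (mv_effect Mt)) {K f, K g})"
  shows "i = K (\<lambda>\<omega>\<in>X. min (f \<omega>) (g \<omega>))"
proof -
  let ?k = "\<lambda>\<omega>\<in>X. min (f \<omega>) (g \<omega>)"
  have k: "?k \<in> Ms" by (rule tribe_min[OF tribe_Ms f g])
  have carr: "carrier (ea_order (mv_effect Mt)) = K ` Ms"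
    by (simp add: ea_order_def carrier_effect)
  have low: "C \<in> Lower (ea_order (mv_effect Mt)) {K f, K g} \<longleftrightarrow> C \<in> K ` Ms \<and>
      le (ea_order (mv_effect Mt)) C (K f) \<and> le (ea_order (mv_effect Mt)) C (K g)" for C
    unfolding Lower_def carr using f g by auto
  have i_low: "i \<in> Lower (ea_order (mv_effect Mt)) {K f, K g}"
    and i_max: "\<And>C. C \<in> Lower (ea_order (mv_effect Mt)) {K f, K g} \<Longrightarrow>
      le (ea_order (mv_effect Mt)) C i"
    using i unfolding greatest_def by blast+
  obtain j where j: "j \<in> Ms" and ij: "i = K j" using i_low unfolding low by blast
  have "AE \<omega> in P. j \<omega> \<le> f \<omega>" "AE \<omega> in P. j \<omega> \<le> g \<omega>"
    using i_low unfolding low ij Mt_le_iff[OF j f] Mt_le_iff[OF j g] by blast+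
  moreover have "K ?k \<in> Lower (ea_order (mv_effect Mt)) {K f, K g}"
    unfolding low Mt_le_iff[OF k f] Mt_le_iff[OF k g] using k by (auto intro: AE_I2)
  then have "AE \<omega> in P. ?k \<omega> \<le> j \<omega>"
    using i_max unfolding ij Mt_le_iff[OF k j, symmetric] by blast
  ultimately have "AE \<omega> in P. j \<omega> = ?k \<omega>"
    using AE_in_X by eventually_elim auto
  then show ?thesis unfolding ij K_eq_iff[OF j k] .
qed

section \<open>MV-conditional expectation as classical conditional expectation\<close>

lemma subalgebra_Ns: "subalgebra P Ns.\<S>"
  unfolding subalgebra_def
proof
  show "sets Ns.\<S> \<subseteq> sets P"
    unfolding Ms.sets_P Ms.sets_\<S> Ns.sets_\<S> using Ns_Ms by (auto simp: tribe_sets_def)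
qed simp

sublocale P: prob_space P by (rule Ms.prob_space_P)

sublocale CE: finite_measure_subalgebra P Ns.\<S>
  by unfold_locales (rule subalgebra_Ns)

abbreviation "\<E> \<equiv> real_cond_exp P Ns.\<S>"

lemma measurable_Ms: "f \<in> Ms \<Longrightarrow> f \<in> borel_measurable P"
  using Ms.measurable Ms.measurable_P_iff by blast

text \<open>For values in the unit interval, the minimum with an indicator is the product with it,
  so the state of the meet is the integral of \<open>star b\<close> over \<open>A\<close>.\<close>

lemma P_star_eq_density:
  assumes b: "b \<in> carrier M"
  shows "P_star M Ms \<eta> m b = density P (\<lambda>\<omega>. ennreal (star b \<omega>))" (is "_ = ?D")
proof -
  have sb: "star b \<in> Ms" by (rule star_in_Ms[OF b])
  have D: "space ?D = X" "sets ?D = tribe_sets X Ms"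
    by (simp_all add: Ms.sets_P)
  have pow: "tribe_sets X Ms \<subseteq> Pow X" by (auto simp: tribe_sets_def)
  \<comment> \<open>\<open>measure_of\<close> depends only on the values of the set function on the
    generated \<sigma>-algebra, so agreement with the density there suffices, and countable
    additivity comes from the density.\<close>
  have "P_star M Ms \<eta> m b = measure_of X (tribe_sets X Ms) (emeasure ?D)"
    unfolding P_star_def
  proof (rule measure_of_eq[OF pow])
    fix A assume "A \<in> sigma_sets X (tribe_sets X Ms)"
    then have A: "A \<in> tribe_sets X Ms"
      by (simp only: sigma_algebra.sigma_sets_eq[OF sigma_algebra_tribe_sets[OF tribe_Ms]])
    let ?f = "\<lambda>\<omega>\<in>X. min (star b \<omega>) (indicator A \<omega>)"
    have "(\<lambda>\<omega>\<in>X. min (star b \<omega>) ((\<lambda>\<omega>\<in>X. indicator A \<omega>) \<omega>)) \<in> Ms"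
      by (intro tribe_min[OF tribe_Ms] sb Ms.indicator_in_tribe A)
    also have "(\<lambda>\<omega>\<in>X. min (star b \<omega>) ((\<lambda>\<omega>\<in>X. indicator A \<omega>) \<omega>)) = ?f"
      by (auto simp: fun_eq_iff)
    finally have f: "?f \<in> Ms" .
    have "emeasure ?D A = (\<integral>\<^sup>+ \<omega>. ennreal (star b \<omega>) * indicator A \<omega> \<partial>P)"
      using measurable_Ms[OF sb] A by (intro emeasure_density) (auto simp: Ms.sets_P)
    also have "\<dots> = (\<integral>\<^sup>+ \<omega>. ennreal (?f \<omega>) \<partial>P)"
      using star_range[OF b] by (intro nn_integral_cong) (auto simp: indicator_def)
    also have "\<dots> = ennreal (\<integral>\<omega>. ?f \<omega> \<partial>P)"
      by (intro nn_integral_eq_integral Ms.integrable_P f)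
        (use AE_range[OF f] in eventually_elim, simp)
    finally show "ennreal (m (\<eta> ?f)) = emeasure ?D A"
      by (simp only: Ms.L_eq_integral[OF f])
  qed
  also have "\<dots> = ?D"
    using measure_of_of_measure[of ?D] by (simp only: D)
  finally show ?thesis .
qed

lemma integrable_mult_Ms:
  assumes f: "f \<in> Ms" and g: "g \<in> Ms"
  shows "integrable P (\<lambda>\<omega>. f \<omega> * g \<omega>)"
proof (rule P.integrable_const_bound[of _ 1])
  show "AE \<omega> in P. norm (f \<omega> * g \<omega>) \<le> 1"
    using AE_range[OF f] AE_range[OF g] by eventually_elim (simp add: mult_le_one)
  show "(\<lambda>\<omega>. f \<omega> * g \<omega>) \<in> borel_measurable P"
    using measurable_Ms[OF f] measurable_Ms[OF g] by (rule borel_measurable_times)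
qed

lemma integrable_P_star:
  assumes b: "b \<in> carrier M" and f: "f \<in> Ms"
  shows "integrable (P_star M Ms \<eta> m b) f"
    and "(\<integral>\<omega>. f \<omega> \<partial>P_star M Ms \<eta> m b) = (\<integral>\<omega>. star b \<omega> * f \<omega> \<partial>P)"
proof -
  note sb = star_in_Ms[OF b]
  have nn: "AE \<omega> in P. 0 \<le> star b \<omega>"
    using AE_range[OF sb] by eventually_elim simp
  show "integrable (P_star M Ms \<eta> m b) f"
    unfolding P_star_eq_density[OF b]
      integrable_density[OF measurable_Ms[OF f] measurable_Ms[OF sb] nn]
    using integrable_mult_Ms[OF sb f] by simp
  show "(\<integral>\<omega>. f \<omega> \<partial>P_star M Ms \<eta> m b) = (\<integral>\<omega>. star b \<omega> * f \<omega> \<partial>P)"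
    unfolding P_star_eq_density[OF b]
      integral_density[OF measurable_Ms[OF f] measurable_Ms[OF sb] nn] by simp
qed

lemma meet_integral:
  assumes a: "a \<in> carrier M" and b: "b \<in> carrier M"
  shows "m (mv_meet M a b) = (\<integral>\<omega>. min (star a \<omega>) (star b \<omega>) \<partial>P)"
proof -
  let ?f = "\<lambda>\<omega>\<in>X. min (star a \<omega>) (star b \<omega>)"
  have f: "?f \<in> Ms" by (intro tribe_min[OF tribe_Ms] star_in_Ms a b)
  have "mv_meet M a b = \<eta> ?f"
    using \<eta>_min[OF star_in_Ms[OF a] star_in_Ms[OF b]] by (simp only: \<eta>_star a b)
  then have "m (mv_meet M a b) = (\<integral>\<omega>. ?f \<omega> \<partial>P)"
    by (simp only: Ms.L_eq_integral[OF f])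
  also have "\<dots> = (\<integral>\<omega>. min (star a \<omega>) (star b \<omega>) \<partial>P)"
    by (intro Bochner_Integration.integral_cong) auto
  finally show ?thesis .
qed

text \<open>Idempotence says \<open>min (2 * t) 1 = t\<close> for each value \<open>t\<close> of
  \<open>star b\<close>, which leaves only 0 and 1.\<close>

lemma boolean_star:
  assumes b: "b \<in> mv_boolean M N"
  obtains A where "A \<in> sets Ns.\<S>" "star b = (\<lambda>\<omega>\<in>X. indicator A \<omega>)"
proof -
  have bN: "b \<in> N" and bb: "mv_plus M b b = b" using b by (auto simp: mv_boolean_def)
  note bM = N_carrier[OF bN]
  have 01: "star b \<omega> = 0 \<or> star b \<omega> = 1" if "\<omega> \<in> X" for \<omega>
  proof -
    have "star (mv_plus M b b) \<omega> = min (star b \<omega> + star b \<omega>) 1"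
      unfolding star_plus[OF bM bM] using that by simp
    then show ?thesis unfolding bb by linarith
  qed
  define A where "A = {\<omega> \<in> X. star b \<omega> = 1}"
  have eq: "star b = (\<lambda>\<omega>\<in>X. indicator A \<omega>)"
    by (rule extensionalityI[OF tribe_extensional[OF tribe_Ms star_in_Ms[OF bM]]])
      (use 01 in \<open>auto simp: A_def indicator_def\<close>)
  have "A \<in> sets Ns.\<S>"
    using star_in_Ns[OF bN] unfolding Ns.sets_\<S> tribe_sets_def eq by (auto simp: A_def)
  then show ?thesis using eq that by blast
qed

text \<open>An indicator is idempotent, hence so is its image under \<open>\<eta>\<close>. Since the
  indicator need not be continuous, it is matched by \<open>star\<close> of that image only almost
  everywhere, both being representatives of one element.\<close>

lemma boolean_of_set:
  assumes A: "A \<in> sets Ns.\<S>"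
  obtains b where "b \<in> mv_boolean M N" "AE \<omega> in P. star b \<omega> = indicator A \<omega>"
proof -
  let ?c = "\<lambda>\<omega>\<in>X. indicator A \<omega> :: real"
  have c: "?c \<in> Ns" using A by (simp add: tribe_sets_def)
  note cM = Ns_Ms[OF c]
  have "(\<lambda>\<omega>\<in>X. min (?c \<omega> + ?c \<omega>) 1) = ?c" by (auto simp: fun_eq_iff indicator_def)
  then have "mv_plus M (\<eta> ?c) (\<eta> ?c) = \<eta> ?c"
    using \<eta>_plus[OF cM cM] by (simp only:)
  then have b: "\<eta> ?c \<in> mv_boolean M N" using \<eta>_Ns[OF c] by (simp add: mv_boolean_def)
  have "K (star (\<eta> ?c)) = K ?c"
    by (simp only: K_def \<eta>_star[OF \<eta>_closed[OF cM]])
  then have "AE \<omega> in P. star (\<eta> ?c) \<omega> = ?c \<omega>"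
    by (simp only: K_eq_iff[OF star_in_Ms[OF \<eta>_closed[OF cM]] cM])
  with AE_in_X have "AE \<omega> in P. star (\<eta> ?c) \<omega> = indicator A \<omega>" by eventually_elim simp
  with b that show ?thesis by blast
qed

text \<open>Boolean elements of \<open>N\<close> and sets of \<open>Ns\<close> correspond up to null
  sets, so testing against the former is testing against the latter.\<close>

lemma mv_cond_exp01_iff:
  assumes a: "a \<in> carrier M"
  shows "mv_cond_exp01 M Ms \<eta> N m a f \<longleftrightarrow> f \<in> Ns \<and>
    (\<forall>A\<in>sets Ns.\<S>. (\<integral>\<omega>. indicator A \<omega> * f \<omega> \<partial>P) = (\<integral>\<omega>. indicator A \<omega> * star a \<omega> \<partial>P))"
proof -
  note sa = star_in_Ms[OF a]
  have "mv_cond_exp01 M Ms \<eta> N m a f \<longleftrightarrow> f \<in> Ns \<and>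
      (\<forall>b\<in>mv_boolean M N. integrable (P_star M Ms \<eta> m b) f \<and>
        (\<integral>\<omega>. f \<omega> \<partial>P_star M Ms \<eta> m b) = m (mv_meet M a b))"
    unfolding mv_cond_exp01_def mv_cond_exp_def Ns.in_tribe_iff Ns.\<S>_def by blast
  also have "\<dots> \<longleftrightarrow> f \<in> Ns \<and> (\<forall>b\<in>mv_boolean M N.
      (\<integral>\<omega>. star b \<omega> * f \<omega> \<partial>P) = (\<integral>\<omega>. min (star a \<omega>) (star b \<omega>) \<partial>P))"
    using N_carrier by (auto simp: mv_boolean_def integrable_P_star[OF _ Ns_Ms] meet_integral[OF a])
  also have "\<dots> \<longleftrightarrow> f \<in> Ns \<and> (\<forall>A\<in>sets Ns.\<S>.
      (\<integral>\<omega>. indicator A \<omega> * f \<omega> \<partial>P) = (\<integral>\<omega>. indicator A \<omega> * star a \<omega> \<partial>P))"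
  proof (intro conj_cong refl)
    assume "f \<in> Ns"
    then have f: "f \<in> Ms" by (rule Ns_Ms)
    \<comment> \<open>This turns the meet in the definition into the product in the classical
      condition; it relies on the second argument being an indicator.\<close>
    have min_ind: "min (star a \<omega>) (indicator A \<omega>) = indicator A \<omega> * star a \<omega>"
      if "\<omega> \<in> X" for \<omega> A
      using star_range[OF a that] by (auto simp: indicator_def)
    have key: "((\<integral>\<omega>. star b \<omega> * f \<omega> \<partial>P) = (\<integral>\<omega>. min (star a \<omega>) (star b \<omega>) \<partial>P)) \<longleftrightarrow>
        (\<integral>\<omega>. indicator A \<omega> * f \<omega> \<partial>P) = (\<integral>\<omega>. indicator A \<omega> * star a \<omega> \<partial>P)"
      if b: "b \<in> mv_boolean M N" and A: "A \<in> sets Ns.\<S>"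
        and eq: "AE \<omega> in P. star b \<omega> = indicator A \<omega>" for A b
    proof -
      have sb: "star b \<in> Ms" using b N_carrier by (auto simp: mv_boolean_def intro: star_in_Ms)
      have A': "A \<in> sets P" using A subalgebra_Ns by (auto simp: subalgebra_def)
      note meas = measurable_Ms[OF f] measurable_Ms[OF sa] measurable_Ms[OF sb]
        borel_measurable_indicator[OF A']
      have "(\<integral>\<omega>. star b \<omega> * f \<omega> \<partial>P) = (\<integral>\<omega>. indicator A \<omega> * f \<omega> \<partial>P)"
      proof (rule integral_cong_AE)
        show "AE \<omega> in P. star b \<omega> * f \<omega> = indicator A \<omega> * f \<omega>"
          using eq by eventually_elim simp
      qed (intro borel_measurable_times meas)+
      moreover have "(\<integral>\<omega>. min (star a \<omega>) (star b \<omega>) \<partial>P) = (\<integral>\<omega>. indicator A \<omega> * star a \<omega> \<partial>P)"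
      proof (rule integral_cong_AE)
        show "AE \<omega> in P. min (star a \<omega>) (star b \<omega>) = indicator A \<omega> * star a \<omega>"
          using eq AE_in_X by eventually_elim (simp add: min_ind)
      qed (intro borel_measurable_times borel_measurable_min meas)+
      ultimately show ?thesis by (simp only:)
    qed
    show "(\<forall>b\<in>mv_boolean M N.
        (\<integral>\<omega>. star b \<omega> * f \<omega> \<partial>P) = (\<integral>\<omega>. min (star a \<omega>) (star b \<omega>) \<partial>P)) \<longleftrightarrow>
      (\<forall>A\<in>sets Ns.\<S>.
        (\<integral>\<omega>. indicator A \<omega> * f \<omega> \<partial>P) = (\<integral>\<omega>. indicator A \<omega> * star a \<omega> \<partial>P))"
    proof (intro iffI ballI)
      fix A assume A: "A \<in> sets Ns.\<S>" and all: "\<forall>b\<in>mv_boolean M N.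
        (\<integral>\<omega>. star b \<omega> * f \<omega> \<partial>P) = (\<integral>\<omega>. min (star a \<omega>) (star b \<omega>) \<partial>P)"
      obtain b where b: "b \<in> mv_boolean M N" "AE \<omega> in P. star b \<omega> = indicator A \<omega>"
        using boolean_of_set[OF A] .
      show "(\<integral>\<omega>. indicator A \<omega> * f \<omega> \<partial>P) = (\<integral>\<omega>. indicator A \<omega> * star a \<omega> \<partial>P)"
        using bspec[OF all b(1)] unfolding key[OF b(1) A b(2)] .
    next
      fix b assume b: "b \<in> mv_boolean M N" and all: "\<forall>A\<in>sets Ns.\<S>.
        (\<integral>\<omega>. indicator A \<omega> * f \<omega> \<partial>P) = (\<integral>\<omega>. indicator A \<omega> * star a \<omega> \<partial>P)"
      obtain A where A: "A \<in> sets Ns.\<S>" "star b = (\<lambda>\<omega>\<in>X. indicator A \<omega>)"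
        using boolean_star[OF b] .
      have "AE \<omega> in P. star b \<omega> = indicator A \<omega>"
        unfolding A(2) using AE_in_X by eventually_elim simp
      from key[OF b A(1) this] bspec[OF all A(1)]
      show "(\<integral>\<omega>. star b \<omega> * f \<omega> \<partial>P) = (\<integral>\<omega>. min (star a \<omega>) (star b \<omega>) \<partial>P)"
        by (simp only:)
    qed
  qed
  finally show ?thesis .
qed

lemma mv_cond_exp01_iff_AE:
  assumes a: "a \<in> carrier M"
  shows "mv_cond_exp01 M Ms \<eta> N m a f \<longleftrightarrow> f \<in> Ns \<and> (AE \<omega> in P. \<E> (star a) \<omega> = f \<omega>)"
  unfolding mv_cond_exp01_iff[OF a]
proof (intro conj_cong refl)
  assume f: "f \<in> Ns"
  note int_a = Ms.integrable_P[OF star_in_Ms[OF a]] and int_f = Ms.integrable_P[OF Ns_Ms[OF f]]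
  show "(\<forall>A\<in>sets Ns.\<S>. (\<integral>\<omega>. indicator A \<omega> * f \<omega> \<partial>P) = (\<integral>\<omega>. indicator A \<omega> * star a \<omega> \<partial>P))
    \<longleftrightarrow> (AE \<omega> in P. \<E> (star a) \<omega> = f \<omega>)"
  proof
    assume *: "\<forall>A\<in>sets Ns.\<S>.
      (\<integral>\<omega>. indicator A \<omega> * f \<omega> \<partial>P) = (\<integral>\<omega>. indicator A \<omega> * star a \<omega> \<partial>P)"
    show "AE \<omega> in P. \<E> (star a) \<omega> = f \<omega>"
      by (rule CE.real_cond_exp_charact[OF _ int_a int_f Ns.measurable[OF f]])
        (use * in \<open>simp add: set_lebesgue_integral_def\<close>)
  next
    assume eq: "AE \<omega> in P. \<E> (star a) \<omega> = f \<omega>"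
    show "\<forall>A\<in>sets Ns.\<S>.
      (\<integral>\<omega>. indicator A \<omega> * f \<omega> \<partial>P) = (\<integral>\<omega>. indicator A \<omega> * star a \<omega> \<partial>P)"
    proof
      fix A assume A: "A \<in> sets Ns.\<S>"
      have A': "A \<in> sets P" using A subalgebra_Ns by (auto simp: subalgebra_def)
      have "(\<integral>\<omega>. indicator A \<omega> * star a \<omega> \<partial>P) = (\<integral>\<omega>. indicator A \<omega> * \<E> (star a) \<omega> \<partial>P)"
        using CE.real_cond_exp_intA[OF int_a A] by (simp add: set_lebesgue_integral_def)
      also have "\<dots> = (\<integral>\<omega>. indicator A \<omega> * f \<omega> \<partial>P)"
      proof (rule integral_cong_AE)
        show "AE \<omega> in P. indicator A \<omega> * \<E> (star a) \<omega> = indicator A \<omega> * f \<omega>"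
          using eq by eventually_elim simp
      qed (intro borel_measurable_times borel_measurable_indicator[OF A']
          borel_measurable_cond_exp2 measurable_Ms[OF Ns_Ms[OF f]])+
      finally show "(\<integral>\<omega>. indicator A \<omega> * f \<omega> \<partial>P) = (\<integral>\<omega>. indicator A \<omega> * star a \<omega> \<partial>P)"
        by (rule sym)
    qed
  qed
qed

text \<open>The classical conditional expectation obeys the bounds of \<open>g\<close> only almost
  everywhere. Clipping it to the unit interval keeps it measurable and changes it on a null set, and
  the result belongs to \<open>Ns\<close> by \<open>in_tribe_iff\<close>.\<close>

lemma cond_exp_version:
  assumes g: "g \<in> Ms"
  obtains f where "f \<in> Ns" "AE \<omega> in P. \<E> g \<omega> = f \<omega>"
proof -
  let ?f = "\<lambda>\<omega>\<in>X. min 1 (max 0 (\<E> g \<omega>))"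
  have "(\<lambda>\<omega>. min 1 (max 0 (\<E> g \<omega>))) \<in> borel_measurable Ns.\<S>"
    by (intro borel_measurable_min borel_measurable_max borel_measurable_const borel_measurable_cond_exp)
  moreover have "?f \<in> borel_measurable Ns.\<S> \<longleftrightarrow>
      (\<lambda>\<omega>. min 1 (max 0 (\<E> g \<omega>))) \<in> borel_measurable Ns.\<S>"
    by (rule measurable_cong) simp
  ultimately have "?f \<in> Ns" unfolding Ns.in_tribe_iff by auto
  have int: "integrable P g" by (rule Ms.integrable_P[OF g])
  have ge0: "AE \<omega> in P. 0 \<le> \<E> g \<omega>"
    by (rule CE.real_cond_exp_ge_c[OF int]) (use AE_range[OF g] in eventually_elim, simp)
  have le1: "AE \<omega> in P. \<E> g \<omega> \<le> 1"
    by (rule CE.real_cond_exp_le_c[OF int]) (use AE_range[OF g] in eventually_elim, simp)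
  have "AE \<omega> in P. \<E> g \<omega> = ?f \<omega>"
    using ge0 le1 AE_in_X by eventually_elim simp
  with \<open>?f \<in> Ns\<close> that show ?thesis by blast
qed

section \<open>The operator on the quotient\<close>

abbreviation "\<tau> \<equiv> cond_exp_operator M Ms \<eta> N m"

text \<open>The description hides two choices, a representative and a version. Equivalent
  representatives have \<open>star\<close> functions, and hence conditional expectations, that agree
  almost everywhere; versions agree almost everywhere by uniqueness. Neither choice affects the
  class.\<close>

lemma \<tau>_K:
  assumes g: "g \<in> Ms" and f: "f \<in> Ns" and fg: "AE \<omega> in P. \<E> g \<omega> = f \<omega>"
  shows "\<tau> (K g) = K f"
  unfolding cond_exp_operator_def
proof (rule the_equality)
  have version_eq: "AE \<omega> in P. \<E> (star a) \<omega> = f \<omega>" if "a \<in> carrier M" "K g = cls a" for a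
  proof -
    have sa: "star a \<in> Ms" by (rule star_in_Ms[OF that(1)])
    have "AE \<omega> in P. g \<omega> = star a \<omega>"
      using that(2) unfolding cls_eq_K[OF that(1)] K_eq_iff[OF g sa] .
    then have "AE \<omega> in P. \<E> g \<omega> = \<E> (star a) \<omega>"
      by (rule CE.real_cond_exp_cong) (rule measurable_Ms[OF g] measurable_Ms[OF sa])+
    with fg show ?thesis by eventually_elim simp
  qed
  have "mv_cond_exp01 M Ms \<eta> N m (\<eta> g) f"
    unfolding mv_cond_exp01_iff_AE[OF \<eta>_closed[OF g]]
    using f version_eq[OF \<eta>_closed[OF g] K_def] by blast
  then show "\<exists>a h. a \<in> carrier M \<and> K g = cls a \<and> mv_cond_exp01 M Ms \<eta> N m a h \<and> K f = cls (\<eta> h)"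
    using \<eta>_closed[OF g] K_def by blast
  fix D
  assume "\<exists>a h. a \<in> carrier M \<and> K g = cls a \<and> mv_cond_exp01 M Ms \<eta> N m a h \<and> D = cls (\<eta> h)"
  then obtain a h where a: "a \<in> carrier M" "K g = cls a"
    and h: "mv_cond_exp01 M Ms \<eta> N m a h" and D: "D = K h"
    unfolding K_def by blast
  have hN: "h \<in> Ns" and h_eq: "AE \<omega> in P. \<E> (star a) \<omega> = h \<omega>"
    using h unfolding mv_cond_exp01_iff_AE[OF a(1)] by blast+
  have "AE \<omega> in P. h \<omega> = f \<omega>"
    using h_eq version_eq[OF a] by eventually_elim simp
  then show "D = K f" unfolding D K_eq_iff[OF Ns_Ms[OF hN] Ns_Ms[OF f]] .
qed

text \<open>Functions measurable for the smaller \<sigma>-algebra are their own conditional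
  expectation. The unit law, idempotence, strongness and one inclusion for the range all reduce to
  this.\<close>

lemma \<tau>_K_self:
  assumes f: "f \<in> Ns"
  shows "\<tau> (K f) = K f"
  by (rule \<tau>_K[OF Ns_Ms[OF f] f],
      rule CE.real_cond_exp_F_meas[OF Ms.integrable_P[OF Ns_Ms[OF f]] Ns.measurable[OF f]])

lemma \<tau>_KE:
  assumes "g \<in> Ms"
  obtains f where "f \<in> Ns" "AE \<omega> in P. \<E> g \<omega> = f \<omega>" "\<tau> (K g) = K f"
proof -
  obtain f where f: "f \<in> Ns" "AE \<omega> in P. \<E> g \<omega> = f \<omega>" using cond_exp_version[OF assms] .
  show ?thesis by (rule that[OF f \<tau>_K[OF assms f]])
qed

lemma strong_state_operator_\<tau>: "strong_state_operator (mv_effect Mt) \<tau>"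
proof (intro strong_state_operator.intro state_operator.intro effect_algebra_Mt
    state_operator_axioms.intro strong_state_operator_axioms.intro)
  show "\<tau> \<in> carrier (mv_effect Mt) \<rightarrow> carrier (mv_effect Mt)"
  proof
    fix A assume "A \<in> carrier (mv_effect Mt)"
    then obtain g where g: "g \<in> Ms" "A = K g" unfolding carrier_effect by blast
    obtain f where "f \<in> Ns" "\<tau> (K g) = K f" by (rule \<tau>_KE[OF g(1)], rule that)
    then show "\<tau> A \<in> carrier (mv_effect Mt)" unfolding g(2) carrier_effect using Ns_Ms by blast
  qed
  have one: "eone (mv_effect Mt) = K (\<lambda>\<omega>\<in>X. 1)"
    by (simp only: mv_effect_def effect_algebra.simps Mt_one)
  show "\<tau> (eone (mv_effect Mt)) = eone (mv_effect Mt)"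
    unfolding one by (rule \<tau>_K_self[OF tribe_one[OF tribe_Ns]])
  show "\<tau> (\<tau> A) = \<tau> A" if "A \<in> carrier (mv_effect Mt)" for A
  proof -
    obtain g where g: "g \<in> Ms" "A = K g" using \<open>A \<in> _\<close> unfolding carrier_effect by blast
    obtain f where f: "f \<in> Ns" "\<tau> (K g) = K f" by (rule \<tau>_KE[OF g(1)], rule that)
    show ?thesis unfolding g(2) f(2) by (rule \<tau>_K_self[OF f(1)])
  qed
  show "osum (mv_effect Mt) (\<tau> A) (\<tau> B) = Some (\<tau> C)"
    if A: "A \<in> carrier (mv_effect Mt)" and B: "B \<in> carrier (mv_effect Mt)"
      and sum: "osum (mv_effect Mt) A B = Some C" for A B C
  proof -
    obtain f where f: "f \<in> Ms" "A = K f" using A unfolding carrier_effect by blast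
    obtain g where g: "g \<in> Ms" "B = K g" using B unfolding carrier_effect by blast
    let ?h = "\<lambda>\<omega>\<in>X. min (f \<omega> + g \<omega>) 1"
    have h: "?h \<in> Ms" by (rule tribe_plus[OF tribe_Ms f(1) g(1)])
    have le: "AE \<omega> in P. f \<omega> + g \<omega> \<le> 1" and C: "C = K ?h"
      using sum unfolding f(2) g(2) Mt_osum_iff[OF f(1) g(1)] by blast+
    obtain u where u: "u \<in> Ns" "AE \<omega> in P. \<E> f \<omega> = u \<omega>" "\<tau> (K f) = K u" using \<tau>_KE[OF f(1)] .
    obtain v where v: "v \<in> Ns" "AE \<omega> in P. \<E> g \<omega> = v \<omega>" "\<tau> (K g) = K v" using \<tau>_KE[OF g(1)] .
    obtain w where w: "w \<in> Ns" "AE \<omega> in P. \<E> ?h \<omega> = w \<omega>" "\<tau> (K ?h) = K w" using \<tau>_KE[OF h] .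
    \<comment> \<open>Orthogonality removes the truncation almost everywhere, and only then does
      linearity of the conditional expectation apply.\<close>
    have "AE \<omega> in P. ?h \<omega> = f \<omega> + g \<omega>" using le AE_in_X by eventually_elim simp
    then have "AE \<omega> in P. \<E> ?h \<omega> = \<E> (\<lambda>\<omega>. f \<omega> + g \<omega>) \<omega>"
      by (rule CE.real_cond_exp_cong)
        (intro measurable_Ms[OF h] borel_measurable_add measurable_Ms f g)+
    moreover have "AE \<omega> in P. \<E> (\<lambda>\<omega>. f \<omega> + g \<omega>) \<omega> = \<E> f \<omega> + \<E> g \<omega>"
      by (rule CE.real_cond_exp_add[OF Ms.integrable_P[OF f(1)] Ms.integrable_P[OF g(1)]])
    ultimately have uvw: "AE \<omega> in P. w \<omega> = u \<omega> + v \<omega>"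
      using u(2) v(2) w(2) by eventually_elim simp
    note M = Ns_Ms[OF u(1)] Ns_Ms[OF v(1)] Ns_Ms[OF w(1)]
    show ?thesis
      unfolding f(2) g(2) C u(3) v(3) w(3) Mt_osum_iff[OF M(1,2)]
        K_eq_iff[OF M(3) tribe_plus[OF tribe_Ms M(1,2)]]
    proof
      \<comment> \<open>The images are orthogonal because their sum agrees almost everywhere with
        \<open>w\<close>, a function of the tribe.\<close>
      show "AE \<omega> in P. u \<omega> + v \<omega> \<le> 1"
        using uvw AE_range[OF M(3)] by eventually_elim simp
      show "AE \<omega> in P. w \<omega> = (\<lambda>\<omega>\<in>X. min (u \<omega> + v \<omega>) 1) \<omega>"
        using uvw AE_range[OF M(3)] AE_in_X by eventually_elim simp
    qed
  qed
  show "\<tau> i = i"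
    if A: "A \<in> carrier (mv_effect Mt)" and B: "B \<in> carrier (mv_effect Mt)"
      and i: "greatest (ea_order (mv_effect Mt)) i (Lower (ea_order (mv_effect Mt)) {\<tau> A, \<tau> B})"
    for A B i
  proof -
    obtain f where f: "f \<in> Ms" "A = K f" using A unfolding carrier_effect by blast
    obtain g where g: "g \<in> Ms" "B = K g" using B unfolding carrier_effect by blast
    obtain u where u: "u \<in> Ns" "\<tau> (K f) = K u" by (rule \<tau>_KE[OF f(1)], rule that)
    obtain v where v: "v \<in> Ns" "\<tau> (K g) = K v" by (rule \<tau>_KE[OF g(1)], rule that)
    \<comment> \<open>The infimum is represented by a minimum of two functions of \<open>Ns\<close>;
      a tribe is closed under minima, so the class is fixed.\<close>
    have "i = K (\<lambda>\<omega>\<in>X. min (u \<omega>) (v \<omega>))"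
      using greatest_lower_bound_Mt[OF Ns_Ms[OF u(1)] Ns_Ms[OF v(1)]] i
      unfolding f(2) g(2) u(2) v(2) by blast
    then show ?thesis using \<tau>_K_self[OF tribe_min[OF tribe_Ns u(1) v(1)]] by (simp only:)
  qed
qed

text \<open>One inclusion holds since versions lie in \<open>Ns\<close> and \<open>\<eta>\<close>
  maps \<open>Ns\<close> into \<open>N\<close>; the other since \<open>star a\<close> for
  \<open>a \<in> N\<close> lies in \<open>Ns\<close> and its class is fixed.\<close>

lemma \<tau>_range: "\<tau> ` carrier Mt = cls ` N"
proof
  show "\<tau> ` carrier Mt \<subseteq> cls ` N"
  proof
    fix D assume "D \<in> \<tau> ` carrier Mt"
    then obtain g where g: "g \<in> Ms" "D = \<tau> (K g)" unfolding carrier_Mt by blast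
    obtain f where f: "f \<in> Ns" "\<tau> (K g) = K f" by (rule \<tau>_KE[OF g(1)], rule that)
    show "D \<in> cls ` N" unfolding g(2) f(2) K_def[of f] using \<eta>_Ns[OF f(1)] by (rule imageI)
  qed
  show "cls ` N \<subseteq> \<tau> ` carrier Mt"
  proof
    fix D assume "D \<in> cls ` N"
    then obtain a where a: "a \<in> N" "D = K (star a)" using cls_eq_K N_carrier by blast
    have "\<tau> (K (star a)) \<in> \<tau> ` carrier Mt"
      unfolding carrier_Mt using star_in_Ms[OF N_carrier[OF a(1)]] by blast
    then show "D \<in> \<tau> ` carrier Mt" unfolding a(2) \<tau>_K_self[OF star_in_Ns[OF a(1)]] .
  qed
qed

lemma mv_cond_exp01_exists:
  assumes a: "a \<in> carrier M"
  shows "\<exists>f. mv_cond_exp01 M Ms \<eta> N m a f"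
  unfolding mv_cond_exp01_iff_AE[OF a] using cond_exp_version[OF star_in_Ms[OF a]] by blast

lemma \<tau>_cls:
  assumes a: "a \<in> carrier M" and f: "mv_cond_exp01 M Ms \<eta> N m a f"
  shows "f \<in> Ns" "\<tau> (cls a) = cls (\<eta> f)"
proof -
  show fN: "f \<in> Ns" using f unfolding mv_cond_exp01_iff_AE[OF a] by blast
  have "AE \<omega> in P. \<E> (star a) \<omega> = f \<omega>" using f unfolding mv_cond_exp01_iff_AE[OF a] by blast
  from \<tau>_K[OF star_in_Ms[OF a] fN this] show "\<tau> (cls a) = cls (\<eta> f)"
    unfolding cls_eq_K[OF a] K_def[of f] .
qed

end

text \<open>As \<open>cond_exp_operator\<close> is a definite description, well-definedness has to
  be expressed through its values: the first conjunct pins them down for every representative and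
  every version at once.\<close>

theorem theorem7p7:
  fixes M :: "('a, 'm) mv_algebra_scheme"
    and sc :: "real \<Rightarrow> 'a \<Rightarrow> 'a"
    and N :: "'a set"
    and m :: "'a \<Rightarrow> real"
    and Ms :: "(('a \<Rightarrow> real) \<Rightarrow> real) set"
    and \<eta> :: "(('a \<Rightarrow> real) \<Rightarrow> real) \<Rightarrow> 'a"
  assumes M: "sigma_mv_algebra M" "convex_structure M sc"
    and N: "sigma_mv_subalgebra N M" "convex_sub sc N"
    and m: "mv_state M m" "mv_sigma_additive M m"
    and LS: "loomis_sikorski M Ms \<eta>"
  defines "cls \<equiv> mv_class M (mv_null_ideal M m)"
    and "Mt \<equiv> mv_quotient M (mv_null_ideal M m)"
    and "\<tau> \<equiv> cond_exp_operator M Ms \<eta> N m"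
  shows "(\<forall>a\<in>carrier M. (\<exists>f. mv_cond_exp01 M Ms \<eta> N m a f) \<and>
            (\<forall>f. mv_cond_exp01 M Ms \<eta> N m a f \<longrightarrow> f \<in> sub_star M N \<and> \<tau> (cls a) = cls (\<eta> f)))
         \<and> strong_state_operator (mv_effect Mt) \<tau>
         \<and> \<tau> ` carrier Mt = cls ` N"
proof -
  interpret ls_setting M sc N m Ms \<eta>
    by (rule ls_setting.intro[OF M N m LS])
  show ?thesis
    unfolding cls_def Mt_def \<tau>_def
  proof (intro conjI ballI allI impI)
    fix a assume a: "a \<in> carrier M"
    show "\<exists>f. mv_cond_exp01 M Ms \<eta> N m a f"
      by (rule mv_cond_exp01_exists[OF a])
    fix f assume f: "mv_cond_exp01 M Ms \<eta> N m a f"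
    show "f \<in> sub_star M N"
      by (rule \<tau>_cls(1)[OF a f])
    show "cond_exp_operator M Ms \<eta> N m (mv_class M (mv_null_ideal M m) a) =
        mv_class M (mv_null_ideal M m) (\<eta> f)"
      by (rule \<tau>_cls(2)[OF a f])
  next
    show "strong_state_operator (mv_effect (mv_quotient M (mv_null_ideal M m)))
        (cond_exp_operator M Ms \<eta> N m)"
      by (rule strong_state_operator_\<tau>)
    show "cond_exp_operator M Ms \<eta> N m ` carrier (mv_quotient M (mv_null_ideal M m)) =
        mv_class M (mv_null_ideal M m) ` N"
      by (rule \<tau>_range)
  qed
qed

end
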